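(* Let $(W,S)$ be an arbitrary Coxeter system, $I\subseteq S$ arbitrary, and use the notation of the context. Let $w_y^s$ be a loop generator of $C$, let $w,u\in Y_I$ and $A\in\mathcal A$. Then $$u\,r(w,w_y^s)\,u^{-1}=r(uw,w_y^s)\quad\text{and}\quad g_A\,r(w,w_y^s)\,g_A^{-1}=r\bigl(\tau_A(w\,p_{x_I,y})_{(x_I)},\,w_{y^A}^s\bigr).$$
   Context: **Coxeter groups.** $(W,S)$ is a Coxeter system, $S$ possibly infinite; $m_{s,t}$ is the order of $st$; $\Gamma$ is the Coxeter graph ($s\ne t$ adjacent iff $m_{s,t}\ge 3$, including $\infty$). $V$ is the real space with basis $\{\alpha_s\mid s\in S\}$ and form $\langle\alpha_s,\alpha_t\rangle=-\cos(\pi/m_{s,t})$ ($=-1$ if $m_{s,t}=\infty$); $W$ acts by $s\cdot v=v-2\langle\alpha_s,v\rangle\alpha_s$. $\Phi=\{w\cdot\alpha_s\}$ is the root system, $\Phi^+$ the positive roots. For $J\subseteq S$, $W_J=\langle J\rangle$; $J$ is of finite type if $W_J$ is finite, and then $w_0(J)$ is the longest element of $W_J$. Irreducible components of $J$ are the vertex sets of the connected components of the full subgraph of $\Gamma$ on $J$. An irreducible $J$ of finite type is of $(-1)$-type if $w_0(J)\in Z(W_J)$. For $J,K\subseteq S$, $J_{\sim K}$ is the union of those connected components of the full subgraph of $\Gamma$ on $J\cup K$ which meet $K$; $J_{\sim s}=J_{\sim\{s\}}$. $\Phi^{\perp J}=\{\gamma\in\Phi\mid\langle\gamma,\alpha_s\rangle=0\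 \forall s\in J\}$, $(\Phi^{\perp J})^+=\Phi^{\perp J}\cap\Phi^+$. **Groupoids.** Fix a set $\Lambda$ with $|\Lambda|=|I|$. $S^{(\Lambda)}$ is the set of injections $x:\Lambda\to S$, $x_\lambda=x(\lambda)$, $x_A=\{x_\lambda\mid\lambda\in A\}$, $[x]=x_\Lambda$. Fix $x_I\in S^{(\Lambda)}$ with $[x_I]=I$. For $x,y\in S^{(\Lambda)}$ put $C_{x,y}=\{w\in W\mid\alpha_{x_\lambda}=w\cdot\alpha_{y_\lambda}\ \forall\lambda\}$, $\mathcal V(C)=\{x\mid C_{x,x_I}\ne\emptyset\}$; $C$ is the resulting groupoid; if $w\in C_{x,y}$ write $x=w\cdot y$. $Y_{x,y}=\{w\in C_{x,y}\mid w\cdot(\Phi^{\perp[y]})^+\subseteq\Phi^+\}$, $Y_I=Y_{x_I,x_I}$. **Graph and tree.** For $x\in\mathcal V(C)$ and $s\in S\smallsetminus[x]$ with $[x]_{\sim s}$ of finite type, let $w_x^s=w_0([x]_{\sim s})w_0([x]_{\sim s}\smallsetminus\{s\})$; it lies in $C_{y,x}$ for a unique $y\in\mathcal V(C)$. It is a loop generator if $w_x^s\cdot x=x$ (the vertex $x$ being remembered). $\mathcal C$ is the graph with vertex set $\mathcal V(C)$ and edges $w_x^s$ from $x$ to $w_x^s\cdot x$, where $w_x^s$ and its inverse $w_y^t$ ($y=w_x^s\cdot x$, $\{t\}=([x]\cup\{s\})\smallsetminus[y]$) are identified as the two orientations of one edge. $\mathcal Y^1$ is $\mathcal C$ with all loops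 deleted; it is connected. Fix a maximal tree $\mathcal T$ of $\mathcal Y^1$; $p_{z,y}$ is the non-backtracking path in $\mathcal T$ from $y$ to $z$. Paths are written from right to left, and a path from $y$ to $z$ also denotes the element of $C_{z,y}$ it represents; elements of $Y$ are exactly those represented by paths in $\mathcal Y^1$. For $q$ a path (or element of $C_{z,y}$) from $y$ to $z$, $q_{(x)}=p_{x,z}\,q\,p_{y,x}$. For $w\in Y_I$ and a loop generator $u$ at a vertex $y$, $r(w,u)=w\,u_{(x_I)}\,w^{-1}=w\,p_{x_I,y}\,u\,p_{y,x_I}\,w^{-1}$. **$\mathcal A$, $\tau_A$, $g_A$.** Say $A\subseteq\Lambda$ is of finite type, an irreducible component of $\Lambda$, of $(-1)$-type, if $(x_I)_A$ is so (an irreducible component of $I$, etc.; the same then holds with $x_I$ replaced by any $x\in\mathcal V(C)$). If $A$ is of finite type and a union of irreducible components of $\Lambda$, define $x^A\in S^{(\Lambda)}$ for $x\in\mathcal V(C)$ by $(x^A)_\lambda=w_0(x_A)x_\lambda w_0(x_A)$. $\widetilde{\mathcal A}$ is the set of such $A$ with $x_I{}^A\in\mathcal V(C)$, a group under symmetric difference; $\mathcal A$ is the subgroup of those $A\in\widetilde{\mathcal A}$ disjoint from every irreducible component of $\Lambda$ of $(-1)$-type. $A\in\widetilde{\mathcal A}$ induces an automorphism $\tau_A$ of $\mathcal C$: $y\mapsto y^A$, $w_y^s\mapsto w_{y^A}^s$; on elements $w\in C_{z,y}$ it is $\tau_A(w)=w_0(z_A)\,w\,w_0(y_A)\in C_{z^A,y^A}$.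 $g_A=p_{x_I,x_I{}^A}\,w_0((x_I)_A)\in Z_W(W_I)$. *)

theory Defs
  imports
    Complex_Main
    "HOL-Library.FuncSet"
    "HOL-Library.Poly_Mapping"
    "HOL-Algebra.Generated_Groups"
    "HOL-Algebra.Multiplicative_Group"
begin

section \<open>Coxeter systems\<close>

text \<open>
  The congruence on words over \<open>S\<close> generated by the Coxeter relations
  \<open>(s t)\<^bsup>m s t\<^esup> = 1\<close>.  The value \<open>m s t = 0\<close> encodes \<open>\<infinity>\<close>; the relation is then vacuous.
\<close>

inductive cox_cong :: "'a set \<Rightarrow> ('a \<Rightarrow> 'a \<Rightarrow> nat) \<Rightarrow> 'a list \<Rightarrow> 'a list \<Rightarrow> bool"
  for S :: "'a set" and m :: "'a \<Rightarrow> 'a \<Rightarrow> nat" where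
  rel: "\<lbrakk>s \<in> S; t \<in> S; us \<in> lists S; vs \<in> lists S\<rbrakk> \<Longrightarrow>
          cox_cong S m (us @ concat (replicate (m s t) [s, t]) @ vs) (us @ vs)"
| refl: "us \<in> lists S \<Longrightarrow> cox_cong S m us us"
| sym: "cox_cong S m us vs \<Longrightarrow> cox_cong S m vs us"
| trans: "cox_cong S m us vs \<Longrightarrow> cox_cong S m vs ws \<Longrightarrow> cox_cong S m us ws"

definition word_prod :: "('a, 'b) monoid_scheme \<Rightarrow> 'a list \<Rightarrow> 'a" where
  "word_prod G ws = foldr (\<lambda>s w. s \<otimes>\<^bsub>G\<^esub> w) ws \<one>\<^bsub>G\<^esub>"

text \<open>
  \<open>W\<close> is generated by the set \<open>S\<close> of elements of order 2, and it is presented by the relations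
  \<open>(s t)\<^bsup>m(s,t)\<^esup> = 1\<close>, where \<open>m(s,t)\<close> is the order of \<open>s t\<close> (\<^const>\<open>group.ord\<close> is 0 on elements of
  infinite order).
\<close>

locale coxeter_system = group W for W :: "('a, 'b) monoid_scheme" (structure) +
  fixes S :: "'a set"
  assumes S_subset: "S \<subseteq> carrier W"
    and S_order: "s \<in> S \<Longrightarrow> ord s = 2"
    and S_generates: "generate W S = carrier W"
    and S_presents: "\<lbrakk>ws \<in> lists S; word_prod W ws = \<one>\<rbrakk> \<Longrightarrow>
          cox_cong S (\<lambda>s t. ord (s \<otimes> t)) ws []"
begin

definition m :: "'a \<Rightarrow> 'a \<Rightarrow> nat" where
  "m s t = ord (s \<otimes> t)"

definition len :: "'a \<Rightarrow> nat" where
  "len w = (LEAST n. \<exists>ws \<in> lists S. length ws = n \<and> word_prod W ws = w)"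

text \<open>
  The space \<open>V\<close> consists of the finitely supported functions with support in \<open>S\<close>;
  \<open>Poly_Mapping.single s c\<close> is \<open>c \<alpha>\<^sub>s\<close>.
\<close>

definition \<alpha> :: "'a \<Rightarrow> 'a \<Rightarrow>\<^sub>0 real" where
  "\<alpha> s = Poly_Mapping.single s 1"

definition cos_form :: "'a \<Rightarrow> 'a \<Rightarrow> real" where
  "cos_form s t = (if m s t = 0 then -1 else - cos (pi / real (m s t)))"

definition form :: "('a \<Rightarrow>\<^sub>0 real) \<Rightarrow> ('a \<Rightarrow>\<^sub>0 real) \<Rightarrow> real" where
  "form u v = (\<Sum>s \<in> Poly_Mapping.keys u. \<Sum>t \<in> Poly_Mapping.keys v.
     Poly_Mapping.lookup u s * Poly_Mapping.lookup v t * cos_form s t)"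

definition refl :: "'a \<Rightarrow> ('a \<Rightarrow>\<^sub>0 real) \<Rightarrow> 'a \<Rightarrow>\<^sub>0 real" where
  "refl s v = v - Poly_Mapping.single s (2 * form (\<alpha> s) v)"

text \<open>
  The action of \<open>w = s\<^sub>1 \<cdots> s\<^sub>n\<close> is \<open>refl s\<^sub>1 \<circ> \<cdots> \<circ> refl s\<^sub>n\<close>.  As the reflections satisfy the Coxeter
  relations on \<open>V\<close>, the choice of the word does not matter.
\<close>

definition act :: "'a \<Rightarrow> ('a \<Rightarrow>\<^sub>0 real) \<Rightarrow> 'a \<Rightarrow>\<^sub>0 real" where
  "act w = foldr refl (SOME ws. ws \<in> lists S \<and> word_prod W ws = w)"

definition roots :: "('a \<Rightarrow>\<^sub>0 real) set" where
  "roots = {act w (\<alpha> s) | w s. w \<in> carrier W \<and> s \<in> S}"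

definition pos_roots :: "('a \<Rightarrow>\<^sub>0 real) set" where
  "pos_roots = {\<gamma> \<in> roots. \<forall>s \<in> S. Poly_Mapping.lookup \<gamma> s \<ge> 0}"

definition perp_roots :: "'a set \<Rightarrow> ('a \<Rightarrow>\<^sub>0 real) set" where
  "perp_roots J = {\<gamma> \<in> roots. \<forall>s \<in> J. form \<gamma> (\<alpha> s) = 0}"

definition pos_perp_roots :: "'a set \<Rightarrow> ('a \<Rightarrow>\<^sub>0 real) set" where
  "pos_perp_roots J = perp_roots J \<inter> pos_roots"

definition parabolic :: "'a set \<Rightarrow> 'a set" where
  "parabolic J = generate W J"

definition finite_type :: "'a set \<Rightarrow> bool" where
  "finite_type J \<longleftrightarrow> finite (parabolic J)"

definition w0 :: "'a set \<Rightarrow> 'a" where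
  "w0 J = (THE w. w \<in> parabolic J \<and> (\<forall>v \<in> parabolic J. len v \<le> len w))"

text \<open>Edges of the full subgraph of the Coxeter graph on \<open>J\<close>; \<open>m s t = 0\<close> means \<open>\<infinity>\<close>.\<close>

definition cox_edges :: "'a set \<Rightarrow> ('a \<times> 'a) set" where
  "cox_edges J = {(s, t). s \<in> J \<and> t \<in> J \<and> s \<noteq> t \<and> (m s t = 0 \<or> m s t \<ge> 3)}"

definition components :: "'a set \<Rightarrow> 'a set set" where
  "components J = J // (cox_edges J)\<^sup>*"

definition irreducible :: "'a set \<Rightarrow> bool" where
  "irreducible J \<longleftrightarrow> components J = {J}"

definition minus_one_type :: "'a set \<Rightarrow> bool" where
  "minus_one_type J \<longleftrightarrow> irreducible J \<and> finite_type J \<and>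
     w0 J \<in> {z \<in> parabolic J. \<forall>v \<in> parabolic J. z \<otimes> v = v \<otimes> z}"

text \<open>The set \<open>J\<^bsub>\<sim>K\<^esub>\<close>.\<close>

definition near :: "'a set \<Rightarrow> 'a set \<Rightarrow> 'a set" where
  "near J K = \<Union> {C \<in> components (J \<union> K). C \<inter> K \<noteq> {}}"

end


section \<open>The groupoid and its graph\<close>

text \<open>
  Elements of \<open>S\<^bsup>(\<Lambda>)\<^esup>\<close> are extensional functions on \<open>\<Lambda>\<close>, so that equality of functions is
  equality on \<open>\<Lambda>\<close>.  Here \<open>\<Lambda>\<close> is a set rather than a type in order to include \<open>I = {}\<close>.
\<close>

locale coxeter_groupoid = coxeter_system W S
  for W :: "('a, 'b) monoid_scheme" (structure) and S :: "'a set" +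
  fixes I :: "'a set" and \<Lambda> :: "'l set" and x\<^sub>I :: "'l \<Rightarrow> 'a"
  assumes I_subset: "I \<subseteq> S"
    and xI_maps: "x\<^sub>I \<in> \<Lambda> \<rightarrow>\<^sub>E S"
    and xI_inj: "inj_on x\<^sub>I \<Lambda>"
    and xI_image: "x\<^sub>I ` \<Lambda> = I"
begin

definition injections :: "('l \<Rightarrow> 'a) set" where
  "injections = {x \<in> \<Lambda> \<rightarrow>\<^sub>E S. inj_on x \<Lambda>}"

definition hom_C :: "('l \<Rightarrow> 'a) \<Rightarrow> ('l \<Rightarrow> 'a) \<Rightarrow> 'a set" where
  "hom_C x y = {w \<in> carrier W. \<forall>l \<in> \<Lambda>. \<alpha> (x l) = act w (\<alpha> (y l))}"

definition verts_C :: "('l \<Rightarrow> 'a) set" where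
  "verts_C = {x \<in> injections. hom_C x x\<^sub>I \<noteq> {}}"

text \<open>\<open>w \<cdot> y\<close> is the \<open>x\<close> with \<open>w \<in> C\<^bsub>x,y\<^esub>\<close>.\<close>

definition vact :: "'a \<Rightarrow> ('l \<Rightarrow> 'a) \<Rightarrow> 'l \<Rightarrow> 'a" where
  "vact w y = (THE x. x \<in> injections \<and> w \<in> hom_C x y)"

definition hom_Y :: "('l \<Rightarrow> 'a) \<Rightarrow> ('l \<Rightarrow> 'a) \<Rightarrow> 'a set" where
  "hom_Y x y = {w \<in> hom_C x y. act w ` pos_perp_roots (y ` \<Lambda>) \<subseteq> pos_roots}"

definition Y_I :: "'a set" where
  "Y_I = hom_Y x\<^sub>I x\<^sub>I"

text \<open>
  An oriented edge \<open>w\<^sub>x\<^sup>s\<close> is represented by the pair \<open>(x, s)\<close>, because distinct edges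
  may have the same end points, and the same element of \<open>W\<close> may label several edges.
\<close>

definition edges_C :: "(('l \<Rightarrow> 'a) \<times> 'a) set" where
  "edges_C = {(x, s). x \<in> verts_C \<and> s \<in> S - x ` \<Lambda> \<and> finite_type (near (x ` \<Lambda>) {s})}"

definition wgen :: "('l \<Rightarrow> 'a) \<Rightarrow> 'a \<Rightarrow> 'a" where
  "wgen x s = w0 (near (x ` \<Lambda>) {s}) \<otimes> w0 (near (x ` \<Lambda>) {s} - {s})"

definition src :: "('l \<Rightarrow> 'a) \<times> 'a \<Rightarrow> 'l \<Rightarrow> 'a" where
  "src e = fst e"

definition tgt :: "('l \<Rightarrow> 'a) \<times> 'a \<Rightarrow> 'l \<Rightarrow> 'a" where
  "tgt e = vact (wgen (fst e) (snd e)) (fst e)"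

definition inv_edge :: "('l \<Rightarrow> 'a) \<times> 'a \<Rightarrow> ('l \<Rightarrow> 'a) \<times> 'a" where
  "inv_edge e = (tgt e, THE t. {t} = (src e ` \<Lambda> \<union> {snd e}) - tgt e ` \<Lambda>)"

definition loop_generator :: "('l \<Rightarrow> 'a) \<Rightarrow> 'a \<Rightarrow> bool" where
  "loop_generator x s \<longleftrightarrow> (x, s) \<in> edges_C \<and> vact (wgen x s) x = x"

definition edges_Y1 :: "(('l \<Rightarrow> 'a) \<times> 'a) set" where
  "edges_Y1 = {e \<in> edges_C. tgt e \<noteq> src e}"

text \<open>
  \<open>path E z es y\<close>: the list \<open>es\<close> is a path from \<open>y\<close> to \<open>z\<close> with edges in \<open>E\<close>.  Paths are written
  from right to left, i.e. the head of \<open>es\<close> is the last edge of the path.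
\<close>

fun path :: "(('l \<Rightarrow> 'a) \<times> 'a) set \<Rightarrow> ('l \<Rightarrow> 'a) \<Rightarrow> (('l \<Rightarrow> 'a) \<times> 'a) list \<Rightarrow> ('l \<Rightarrow> 'a) \<Rightarrow> bool"
where
  "path E z [] y \<longleftrightarrow> z = y \<and> y \<in> verts_C"
| "path E z (e # es) y \<longleftrightarrow> e \<in> E \<and> tgt e = z \<and> path E (src e) es y"

definition path_elem :: "(('l \<Rightarrow> 'a) \<times> 'a) list \<Rightarrow> 'a" where
  "path_elem es = word_prod W (map (\<lambda>e. wgen (fst e) (snd e)) es)"

definition non_backtracking :: "(('l \<Rightarrow> 'a) \<times> 'a) list \<Rightarrow> bool" where
  "non_backtracking es \<longleftrightarrow> (\<forall>i. Suc i < length es \<longrightarrow> es ! i \<noteq> inv_edge (es ! Suc i))"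

text \<open>
  A circuit is a nonempty closed path without repeated vertices.  The condition
  \<open>non_backtracking\<close> excludes an edge followed by its inverse, but not two different
  edges between the same two vertices.
\<close>

definition circuit :: "(('l \<Rightarrow> 'a) \<times> 'a) set \<Rightarrow> (('l \<Rightarrow> 'a) \<times> 'a) list \<Rightarrow> bool" where
  "circuit E es \<longleftrightarrow> es \<noteq> [] \<and> (\<exists>y. path E y es y) \<and> distinct (map src es) \<and> non_backtracking es"

text \<open>
  A maximal tree of the connected graph \<open>\<Y>\<^sup>1\<close>, given by its set of oriented edges: a subgraph
  that is a tree and contains all vertices.
\<close>

definition maximal_tree :: "(('l \<Rightarrow> 'a) \<times> 'a) set \<Rightarrow> bool" where
  "maximal_tree T \<longleftrightarrow> T \<subseteq> edges_Y1 \<and> inv_edge ` T \<subseteq> T \<and>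
     (\<forall>y \<in> verts_C. \<forall>z \<in> verts_C. \<exists>es. path T z es y) \<and>
     (\<nexists>es. circuit T es)"


text \<open>
  \<open>A \<subseteq> \<Lambda>\<close> inherits its type from \<open>(x\<^sub>I)\<^sub>A\<close>.
\<close>

definition components_\<Lambda> :: "'l set set" where
  "components_\<Lambda> = {A. A \<subseteq> \<Lambda> \<and> x\<^sub>I ` A \<in> components I}"

text \<open>The map \<open>x\<^sup>A\<close>.\<close>

definition twist :: "('l \<Rightarrow> 'a) \<Rightarrow> 'l set \<Rightarrow> 'l \<Rightarrow> 'a" where
  "twist x A = (\<lambda>l \<in> \<Lambda>. w0 (x ` A) \<otimes> x l \<otimes> w0 (x ` A))"

definition A_tilde :: "'l set set" where
  "A_tilde = {A. finite_type (x\<^sub>I ` A) \<and> (\<exists>\<B> \<subseteq> components_\<Lambda>. A = \<Union>\<B>) \<and> twist x\<^sub>I A \<in> verts_C}"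

definition A_group :: "'l set set" where
  "A_group = {A \<in> A_tilde. \<forall>B \<in> components_\<Lambda>. minus_one_type (x\<^sub>I ` B) \<longrightarrow> A \<inter> B = {}}"

text \<open>\<open>\<tau>\<^sub>A(w)\<close> for \<open>w \<in> C\<^bsub>z,y\<^esub>\<close>.\<close>

definition \<tau> :: "'l set \<Rightarrow> ('l \<Rightarrow> 'a) \<Rightarrow> ('l \<Rightarrow> 'a) \<Rightarrow> 'a \<Rightarrow> 'a" where
  "\<tau> A z y w = w0 (z ` A) \<otimes> w \<otimes> w0 (y ` A)"

end


section \<open>The elements defined by a maximal tree\<close>

locale coxeter_groupoid_tree = coxeter_groupoid W S I \<Lambda> x\<^sub>I
  for W :: "('a, 'b) monoid_scheme" (structure) and S :: "'a set" and I :: "'a set"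
    and \<Lambda> :: "'l set" and x\<^sub>I :: "'l \<Rightarrow> 'a" +
  fixes T :: "(('l \<Rightarrow> 'a) \<times> 'a) set"
  assumes T_maximal_tree: "maximal_tree T"
begin

definition tree_path :: "('l \<Rightarrow> 'a) \<Rightarrow> ('l \<Rightarrow> 'a) \<Rightarrow> (('l \<Rightarrow> 'a) \<times> 'a) list" where
  "tree_path z y = (THE es. path T z es y \<and> non_backtracking es)"

text \<open>The element of \<open>C\<^bsub>z,y\<^esub>\<close> represented by the path \<open>p\<^bsub>z,y\<^esub>\<close>.\<close>

definition p :: "('l \<Rightarrow> 'a) \<Rightarrow> ('l \<Rightarrow> 'a) \<Rightarrow> 'a" where
  "p z y = path_elem (tree_path z y)"

text \<open>\<open>q\<^bsub>(x)\<^esub>\<close> for \<open>q \<in> C\<^bsub>z,y\<^esub>\<close>.\<close>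

definition based :: "('l \<Rightarrow> 'a) \<Rightarrow> ('l \<Rightarrow> 'a) \<Rightarrow> ('l \<Rightarrow> 'a) \<Rightarrow> 'a \<Rightarrow> 'a" where
  "based x z y q = p x z \<otimes> q \<otimes> p y x"

text \<open>\<open>r(w,u)\<close> for a loop generator \<open>u\<close> at the vertex \<open>y\<close>.\<close>

definition r :: "'a \<Rightarrow> ('l \<Rightarrow> 'a) \<Rightarrow> 'a \<Rightarrow> 'a" where
  "r w y u = w \<otimes> based x\<^sub>I y y u \<otimes> inv w"

definition g :: "'l set \<Rightarrow> 'a" where
  "g A = p x\<^sub>I (twist x\<^sub>I A) \<otimes> w0 (x\<^sub>I ` A)"

end

end

(*
  A loop generator v = w_y^s commutes with every simple reflection in [y], since it fixes the
  corresponding simple roots; hence it commutes with w_0(y_A).  Moreover [y^A] = [y], so that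
  w_{y^A}^s and v are the same element of W.  Together with p_{y,z} = p_{z,y}^{-1}, both sides of
  the second identity become conjugates of v by g_A w p_{x_I,y}.

  That w_y^s maps the simple roots alpha_{y_l} to simple roots follows from the action of longest
  elements on simple roots, w_0(J) alpha_s = - alpha_t with t = w_0(J) s w_0(J), which rests on the positivity of
  roots and the exchange condition.  As w_y^s and the reversed edge are mutually inverse, reduced
  paths in the tree can be reversed, and they are unique because the tree has no circuit.
*)
theory Submission
  imports Defs
begin

text \<open>\<open>W\<close> is known only through its presentation and \<open>S\<close> may be
  infinite, so identities in \<open>W\<close> are not checked by computing with words or matrices.
  The substitute is a sign test: an element mapping every simple root to a vector with nonnegative
  coefficients is the identity. It turns w \<alpha>_s = \<alpha>_t into w s w^-1 = t, and its
  version relative to a subset J of S characterises w_0(J) by its signs on simple roots. The test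
  rests on the positivity of roots, which is reduced to rank two, where the coefficients are
  explicit and obey a three-term recurrence. The second obstacle is that the action, w_0, the
  targets and inverses of edges, and the reduced tree paths are all given by choice or definite
  description; each has to be shown well defined before it can be computed with. For the action this
  means verifying the Coxeter relations for reflections.\<close>

section \<open>Finitely supported vectors and the nonnegative cone\<close>

definition smul :: "real \<Rightarrow> ('a \<Rightarrow>\<^sub>0 real) \<Rightarrow> 'a \<Rightarrow>\<^sub>0 real" where
  "smul c v = Poly_Mapping.map ((*) c) v"

lemma lookup_smul [simp]: "Poly_Mapping.lookup (smul c v) s = c * Poly_Mapping.lookup v s"
  unfolding smul_def by transfer (simp add: when_def)

lemma smul_single [simp]: "smul c (Poly_Mapping.single s d) = Poly_Mapping.single s (c * d)"
  by (rule poly_mapping_eqI) (simp add: lookup_single when_def)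

lemma smul_simps:
  "smul c (u + v) = smul c u + smul c v"
  "smul (c + d) v = smul c v + smul d v"
  "smul c (smul d v) = smul (c * d) v"
  "smul 1 v = v"
  "smul 0 v = 0"
  "smul c 0 = 0"
  by (rule poly_mapping_eqI; simp add: lookup_add algebra_simps)+

lemma smul_cancel: "smul c u = smul c v \<Longrightarrow> c \<noteq> 0 \<Longrightarrow> u = v"
  by (rule poly_mapping_eqI) (metis lookup_smul mult_left_cancel)

text \<open>Coefficients are tested at every index, not only on \<open>S\<close>. For vectors
  supported in \<open>S\<close> this is the same condition, and it gives antisymmetry without any
  assumption on supports.\<close>

definition nonneg :: "('a \<Rightarrow>\<^sub>0 real) \<Rightarrow> bool" where
  "nonneg v \<longleftrightarrow> (\<forall>s. Poly_Mapping.lookup v s \<ge> 0)"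

lemma nonneg_add: "nonneg u \<Longrightarrow> nonneg v \<Longrightarrow> nonneg (u + v)"
  by (simp add: nonneg_def lookup_add)

lemma nonneg_smul: "0 \<le> c \<Longrightarrow> nonneg v \<Longrightarrow> nonneg (smul c v)"
  by (simp add: nonneg_def)

lemma nonneg_antisym: "nonneg v \<Longrightarrow> nonneg (- v) \<Longrightarrow> v = 0"
  by (rule poly_mapping_eqI) (simp add: nonneg_def, metis antisym neg_0_le_iff_le)

lemma poly_mapping_eq_sum_single:
  "v = (\<Sum>s\<in>Poly_Mapping.keys v. Poly_Mapping.single s (Poly_Mapping.lookup v s))"
  by (rule poly_mapping_eqI)
    (simp add: lookup_sum lookup_single when_def in_keys_iff)

context coxeter_system
begin

subsection \<open>The geometric representation\<close>

text \<open>The defining sum runs over supports, which change under addition. Summing over common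
  finite supersets is what makes bilinearity a termwise computation.\<close>

lemma form_eq_sum:
  assumes "finite F" "Poly_Mapping.keys u \<subseteq> F" "finite G" "Poly_Mapping.keys v \<subseteq> G"
  shows "form u v = (\<Sum>s\<in>F. \<Sum>t\<in>G.
    Poly_Mapping.lookup u s * Poly_Mapping.lookup v t * cos_form s t)"
proof -
  have "form u v = (\<Sum>s\<in>Poly_Mapping.keys u. \<Sum>t\<in>G.
    Poly_Mapping.lookup u s * Poly_Mapping.lookup v t * cos_form s t)"
    unfolding form_def
    by (intro sum.cong refl sum.mono_neutral_left) (use assms in \<open>auto simp: in_keys_iff\<close>)
  also have "\<dots> = (\<Sum>s\<in>F. \<Sum>t\<in>G.
    Poly_Mapping.lookup u s * Poly_Mapping.lookup v t * cos_form s t)"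
    by (intro sum.mono_neutral_left) (use assms in \<open>auto simp: in_keys_iff\<close>)
  finally show ?thesis .
qed

lemma form_add_right: "form u (v + v') = form u v + form u v'"
proof -
  let ?F = "Poly_Mapping.keys u" and ?G = "Poly_Mapping.keys v \<union> Poly_Mapping.keys v'"
  have "Poly_Mapping.keys (v + v') \<subseteq> ?G" by (rule Poly_Mapping.keys_add)
  then show ?thesis
    by (simp add: form_eq_sum[of ?F _ ?G] lookup_add algebra_simps sum.distrib)
qed

lemma form_add_left: "form (u + u') v = form u v + form u' v"
proof -
  let ?G = "Poly_Mapping.keys v" and ?F = "Poly_Mapping.keys u \<union> Poly_Mapping.keys u'"
  have "Poly_Mapping.keys (u + u') \<subseteq> ?F" by (rule Poly_Mapping.keys_add)
  then show ?thesis
    by (simp add: form_eq_sum[of ?F _ ?G] lookup_add algebra_simps sum.distrib)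
qed

lemma keys_smul: "Poly_Mapping.keys (smul c v) \<subseteq> Poly_Mapping.keys v"
  by (auto simp: in_keys_iff)

lemma form_smul_right: "form u (smul c v) = c * form u v"
  using keys_smul[of c v]
  by (simp add: form_eq_sum[of "Poly_Mapping.keys u" _ "Poly_Mapping.keys v"]
      sum_distrib_left algebra_simps)

lemma form_smul_left: "form (smul c u) v = c * form u v"
  using keys_smul[of c u]
  by (simp add: form_eq_sum[of "Poly_Mapping.keys u" _ "Poly_Mapping.keys v"]
      sum_distrib_left algebra_simps)

lemma smul_alpha: "Poly_Mapping.single s c = smul c (\<alpha> s)"
  by (simp add: \<alpha>_def)

lemma lookup_alpha: "Poly_Mapping.lookup (\<alpha> s) t = (if s = t then 1 else 0)"
  by (simp add: \<alpha>_def lookup_single when_def)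

lemma keys_alpha [simp]: "Poly_Mapping.keys (\<alpha> s) = {s}"
  by (simp add: \<alpha>_def)

lemma alpha_eq_iff [simp]: "\<alpha> s = \<alpha> t \<longleftrightarrow> s = t"
  by (metis keys_alpha singleton_insert_inj_eq')

lemma alpha_nonzero [simp]: "\<alpha> s \<noteq> 0"
  by (metis keys_alpha keys_zero insert_not_empty)

lemma nonneg_alpha: "nonneg (\<alpha> s)"
  by (simp add: nonneg_def lookup_alpha)

lemma form_alpha [simp]: "form (\<alpha> s) (\<alpha> t) = cos_form s t"
  by (simp add: form_def lookup_alpha)

lemma S_carrier: "s \<in> S \<Longrightarrow> s \<in> carrier W"
  using S_subset by auto

lemma S_square [simp]: "s \<in> S \<Longrightarrow> s \<otimes> s = \<one>"
  using pow_ord_eq_1[of s] S_order[of s] S_carrier[of s] by (simp add: numeral_2_eq_2)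

lemma S_inv [simp]: "s \<in> S \<Longrightarrow> inv s = s"
  using S_square S_carrier by (simp add: inv_equality)

lemma S_cancel [simp]: "s \<in> S \<Longrightarrow> w \<in> carrier W \<Longrightarrow> s \<otimes> (s \<otimes> w) = w"
  using S_carrier by (simp flip: m_assoc)

lemma S_cancel_right [simp]: "s \<in> S \<Longrightarrow> w \<in> carrier W \<Longrightarrow> w \<otimes> s \<otimes> s = w"
  using S_carrier by (simp add: m_assoc)

lemma m_commute: "s \<in> S \<Longrightarrow> t \<in> S \<Longrightarrow> m s t = m t s"
  unfolding m_def using ord_inv[of "s \<otimes> t"] by (simp add: S_carrier inv_mult_group)

lemma cos_form_commute: "s \<in> S \<Longrightarrow> t \<in> S \<Longrightarrow> cos_form s t = cos_form t s"
  by (simp add: cos_form_def m_commute)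

lemma m_eq_1_iff: "s \<in> S \<Longrightarrow> t \<in> S \<Longrightarrow> m s t = 1 \<longleftrightarrow> s = t"
proof -
  assume s: "s \<in> S" and t: "t \<in> S"
  have "s = t" if "s \<otimes> t = \<one>"
    using inv_equality[OF that] s t by (simp add: S_carrier)
  then show ?thesis
    unfolding m_def using s t ord_eq_1[of "s \<otimes> t"] by (auto simp: S_carrier)
qed

lemma cos_form_self [simp]: "s \<in> S \<Longrightarrow> cos_form s s = 1"
  using m_eq_1_iff[of s s] by (simp add: cos_form_def)

lemma cos_form_eq_0: "m s t = 2 \<Longrightarrow> cos_form s t = 0"
  by (simp add: cos_form_def)

lemma m_eq_2_commute: "s \<in> S \<Longrightarrow> t \<in> S \<Longrightarrow> m s t = 2 \<Longrightarrow> s \<otimes> t = t \<otimes> s"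
proof -
  assume s: "s \<in> S" and t: "t \<in> S" and "m s t = 2"
  then have "(s \<otimes> t) \<otimes> (s \<otimes> t) = \<one>"
    using pow_ord_eq_1[of "s \<otimes> t"] by (simp add: m_def numeral_2_eq_2 S_carrier)
  from inv_equality[OF this] show ?thesis
    using s t by (simp add: S_carrier inv_mult_group)
qed

lemma refl_alt: "refl s v = v + smul (- 2 * form (\<alpha> s) v) (\<alpha> s)"
  unfolding refl_def by (rule poly_mapping_eqI) (simp add: lookup_add lookup_minus \<alpha>_def lookup_single when_def)

lemma refl_add: "refl s (u + v) = refl s u + refl s v"
  by (rule poly_mapping_eqI) (simp add: refl_alt form_add_right lookup_add algebra_simps)

lemma refl_smul: "refl s (smul c v) = smul c (refl s v)"
  by (simp add: refl_alt form_smul_right smul_simps algebra_simps)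

lemma smul_minus_one: "smul (- 1) v = - v"
  by (rule poly_mapping_eqI) simp

lemma refl_alpha: "s \<in> S \<Longrightarrow> refl s (\<alpha> s) = - \<alpha> s"
  by (rule poly_mapping_eqI) (simp add: refl_alt lookup_add)

lemma refl_orthogonal: "form (\<alpha> s) v = 0 \<Longrightarrow> refl s v = v"
  by (simp add: refl_alt smul_simps)

lemma refl_refl: "s \<in> S \<Longrightarrow> refl s (refl s v) = v"
  by (rule poly_mapping_eqI) (simp add: refl_alt lookup_add form_add_right form_smul_right algebra_simps)

lemma foldr_refl_add: "foldr refl ws (u + v) = foldr refl ws u + foldr refl ws v"
  by (induction ws) (simp_all add: refl_add)

lemma foldr_refl_smul: "foldr refl ws (smul c v) = smul c (foldr refl ws v)"
  by (induction ws) (simp_all add: refl_smul)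

section \<open>The Coxeter relations for reflections\<close>

lemma sin_add_two: "sin ((x + 2) * \<theta>) = 2 * cos \<theta> * sin ((x + 1) * \<theta>) - sin (x * \<theta>)" for x \<theta> :: real
proof -
  have "sin ((x + 2) * \<theta>) = sin ((x + 1) * \<theta> + \<theta>)" "sin (x * \<theta>) = sin ((x + 1) * \<theta> - \<theta>)"
    by (simp_all add: algebra_simps)
  then show ?thesis unfolding sin_add sin_diff by simp
qed

text \<open>Each reflection replaces one of two consecutive sines by the next term of the recurrence
  \<open>sin_add_two\<close>, so s t advances the parameter by 2. Keeping x real and arbitrary
  allows special values that isolate either basis vector.\<close>

lemma refl_rotation_plane:
  assumes "s \<in> S" "t \<in> S" and c: "cos_form s t = - cos \<theta>"
  shows "foldr refl (concat (replicate k [s, t]))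
      (smul (sin ((x + 1) * \<theta>)) (\<alpha> s) + smul (sin (x * \<theta>)) (\<alpha> t))
    = smul (sin ((x + 2 * k + 1) * \<theta>)) (\<alpha> s) + smul (sin ((x + 2 * k) * \<theta>)) (\<alpha> t)"
proof (induction k)
  case (Suc k)
  define y where "y = x + 2 * real k"
  have c': "cos_form t s = - cos \<theta>" using cos_form_commute assms by metis
  have t: "refl t (smul (sin ((y + 1) * \<theta>)) (\<alpha> s) + smul (sin (y * \<theta>)) (\<alpha> t))
    = smul (sin ((y + 1) * \<theta>)) (\<alpha> s) + smul (sin ((y + 2) * \<theta>)) (\<alpha> t)"
    unfolding sin_add_two
    by (rule poly_mapping_eqI)
      (simp add: refl_alt lookup_add form_add_right form_smul_right assms c' algebra_simps)
  have sin3: "sin ((y + 3) * \<theta>) = 2 * cos \<theta> * sin ((y + 2) * \<theta>) - sin ((y + 1) * \<theta>)"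
    using sin_add_two[of "y + 1" \<theta>] by (simp add: add.commute)
  have s: "refl s (smul (sin ((y + 1) * \<theta>)) (\<alpha> s) + smul (sin ((y + 2) * \<theta>)) (\<alpha> t))
    = smul (sin ((y + 3) * \<theta>)) (\<alpha> s) + smul (sin ((y + 2) * \<theta>)) (\<alpha> t)"
    unfolding sin3
    by (rule poly_mapping_eqI)
      (simp add: refl_alt lookup_add form_add_right form_smul_right assms algebra_simps)
  have *: "concat (replicate (Suc k) [s, t]) = [s, t] @ concat (replicate k [s, t])" by simp
  have "foldr refl (concat (replicate (Suc k) [s, t]))
      (smul (sin ((x + 1) * \<theta>)) (\<alpha> s) + smul (sin (x * \<theta>)) (\<alpha> t))
    = refl s (refl t (smul (sin ((y + 1) * \<theta>)) (\<alpha> s) + smul (sin (y * \<theta>)) (\<alpha> t)))"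
    using Suc.IH unfolding * foldr_append by (simp add: y_def)
  also have "\<dots> = smul (sin ((y + 3) * \<theta>)) (\<alpha> s) + smul (sin ((y + 2) * \<theta>)) (\<alpha> t)"
    by (simp only: s t)
  finally show ?case by (simp add: y_def algebra_simps)
qed simp

lemma foldr_refl_fix:
  "(\<And>s. s \<in> set ws \<Longrightarrow> form (\<alpha> s) v = 0) \<Longrightarrow> foldr refl ws v = v"
  by (induction ws) (simp_all add: refl_orthogonal)

text \<open>For finite \<open>m s t\<close> the form is nondegenerate on the plane spanned by \<open>\<alpha>\<^sub>s\<close> and \<open>\<alpha>\<^sub>t\<close>, on which
  \<open>s t\<close> is a rotation, and \<open>s t\<close> fixes the orthogonal complement of this plane.\<close>

lemma refl_relation:
  assumes s: "s \<in> S" and t: "t \<in> S"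
  shows "foldr refl (concat (replicate (m s t) [s, t])) v = v"
proof (cases "s = t \<or> m s t = 0")
  case True
  moreover have "foldr refl (concat (replicate k [s, s])) v = v" for k
    using s by (induction k) (simp_all add: refl_refl)
  ultimately show ?thesis by auto
next
  case False
  define \<theta> where "\<theta> = pi / real (m s t)"
  have m2: "m s t \<ge> 2" using False m_eq_1_iff[OF s t] by linarith
  have c: "cos_form s t = - cos \<theta>" using False by (simp add: cos_form_def \<theta>_def)
  have c': "cos_form t s = - cos \<theta>" using c cos_form_commute[OF s t] by simp
  have sin_pos: "sin \<theta> > 0"
    using m2 by (intro sin_gt_zero) (auto simp: \<theta>_def field_simps)
  let ?f = "foldr refl (concat (replicate (m s t) [s, t]))"
  \<comment> \<open>The power (s t)^m advances the parameter by 2 m, and 2 m \<theta> = 2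
    pi.\<close>
  have per: "sin ((x + real (2 * m s t)) * \<theta>) = sin (x * \<theta>)" for x
  proof -
    have "(x + real (2 * m s t)) * \<theta> = x * \<theta> + 2 * pi"
      using m2 by (simp add: \<theta>_def field_simps)
    then show ?thesis by simp
  qed
  have plane: "?f (smul (sin ((x + 1) * \<theta>)) (\<alpha> s) + smul (sin (x * \<theta>)) (\<alpha> t))
      = smul (sin ((x + 1) * \<theta>)) (\<alpha> s) + smul (sin (x * \<theta>)) (\<alpha> t)" for x
  proof -
    have "x + real (2 * m s t) + 1 = (x + 1) + real (2 * m s t)" by simp
    then show ?thesis
      unfolding refl_rotation_plane[OF s t c] by (simp only: per)
  qed
  \<comment> \<open>The parameters 0 and -1 leave a multiple of \<alpha>_s alone and of \<alpha>_t
    alone; sin \<theta> > 0 allows the factor to be cancelled.\<close>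
  have "?f (smul (sin \<theta>) (\<alpha> s)) = smul (sin \<theta>) (\<alpha> s)"
    using plane[of 0] by (simp add: smul_simps)
  then have fs: "?f (\<alpha> s) = \<alpha> s"
    using sin_pos by - (rule smul_cancel[of "sin \<theta>"], simp_all add: foldr_refl_smul)
  have "?f (smul (- sin \<theta>) (\<alpha> t)) = smul (- sin \<theta>) (\<alpha> t)"
    using plane[of "-1"] by (simp add: smul_simps)
  then have ft: "?f (\<alpha> t) = \<alpha> t"
    using sin_pos by - (rule smul_cancel[of "- sin \<theta>"], simp_all add: foldr_refl_smul)
  \<comment> \<open>The Gram determinant of \<alpha>_s and \<alpha>_t. By Cramer's rule,
    \<open>p\<close> and \<open>q\<close> are then the coefficients of the orthogonal projection of
    v to the plane.\<close>
  define d where "d = (sin \<theta>)\<^sup>2"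
  have d: "d \<noteq> 0" "d = 1 - cos \<theta> * cos \<theta>"
    using sin_pos sin_cos_squared_add[of \<theta>] by (auto simp: d_def power2_eq_square)
  define p where "p = (form (\<alpha> s) v + cos \<theta> * form (\<alpha> t) v) / d"
  define q where "q = (form (\<alpha> t) v + cos \<theta> * form (\<alpha> s) v) / d"
  have pq: "p - cos \<theta> * q = form (\<alpha> s) v" "q - cos \<theta> * p = form (\<alpha> t) v"
  proof -
    have "p - cos \<theta> * q = (1 - cos \<theta> * cos \<theta>) * form (\<alpha> s) v / d"
      "q - cos \<theta> * p = (1 - cos \<theta> * cos \<theta>) * form (\<alpha> t) v / d"
      by (simp_all add: p_def q_def diff_divide_distrib add_divide_distrib algebra_simps)
    then show "p - cos \<theta> * q = form (\<alpha> s) v" "q - cos \<theta> * p = form (\<alpha> t) v"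
      using d by simp_all
  qed
  define h where "h = v + (smul (- p) (\<alpha> s) + smul (- q) (\<alpha> t))"
  have v: "v = h + (smul p (\<alpha> s) + smul q (\<alpha> t))"
    by (rule poly_mapping_eqI) (simp add: h_def lookup_add)
  have "form (\<alpha> s) h = 0" "form (\<alpha> t) h = 0"
    using pq s t c c' by (simp_all add: h_def form_add_right form_smul_right algebra_simps)
  then have "?f h = h"
    by (intro foldr_refl_fix) (auto split: if_splits)
  then have "?f (h + (smul p (\<alpha> s) + smul q (\<alpha> t))) = h + (smul p (\<alpha> s) + smul q (\<alpha> t))"
    by (simp only: foldr_refl_add foldr_refl_smul fs ft)
  then show ?thesis
    by (simp only: v[symmetric])
qed

lemma cox_cong_refl_action:
  "cox_cong S (\<lambda>s t. ord (s \<otimes> t)) us vs \<Longrightarrow> foldr refl us = foldr refl vs"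
proof (induction rule: cox_cong.induct)
  case (rel s t us vs)
  then show ?case
    using refl_relation[of s t] by (intro ext) (simp add: m_def)
qed simp_all

section \<open>Words and the action of the group\<close>

lemma word_prod_Nil [simp]: "word_prod W [] = \<one>"
  by (simp add: word_prod_def)

lemma word_prod_Cons [simp]: "word_prod W (s # ws) = s \<otimes> word_prod W ws"
  by (simp add: word_prod_def)

lemma word_prod_closed [simp]: "ws \<in> lists (carrier W) \<Longrightarrow> word_prod W ws \<in> carrier W"
  by (induction ws) auto

lemma word_prod_closed_S [simp]: "ws \<in> lists S \<Longrightarrow> word_prod W ws \<in> carrier W"
  using S_subset by (intro word_prod_closed) (auto simp: in_lists_conv_set)

lemma word_prod_append [simp]:
  "us \<in> lists (carrier W) \<Longrightarrow> vs \<in> lists (carrier W) \<Longrightarrow>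
    word_prod W (us @ vs) = word_prod W us \<otimes> word_prod W vs"
  by (induction us) (auto simp: m_assoc)

lemma lists_S_carrier [simp]: "ws \<in> lists S \<Longrightarrow> ws \<in> lists (carrier W)"
  using S_subset by (auto simp: in_lists_conv_set)

lemma word_prod_rev: "ws \<in> lists S \<Longrightarrow> word_prod W (rev ws) = inv (word_prod W ws)"
proof (induction ws)
  case (Cons s ws)
  then have "rev ws \<in> lists S" by (auto simp: in_lists_conv_set)
  with Cons show ?case by (auto simp: inv_mult_group S_carrier)
qed simp

lemma foldr_refl_rev: "ws \<in> lists S \<Longrightarrow> foldr refl (rev ws) (foldr refl ws v) = v"
  by (induction ws arbitrary: v) (auto simp: refl_refl)

text \<open>The presentation speaks only of words with product one, so two words are compared
  through \<open>rev vs @ us\<close>. Both conclusions are invariants of the congruence: the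
  composed reflections by \<open>refl_relation\<close>, the parity because every relator has even
  length.\<close>

lemma words_same_product:
  assumes "us \<in> lists S" "vs \<in> lists S" "word_prod W us = word_prod W vs"
  shows "foldr refl us = foldr refl vs" "even (length us) = even (length vs)"
proof -
  have r: "rev vs \<in> lists S" using assms by (auto simp: in_lists_conv_set)
  then have "word_prod W (rev vs @ us) = \<one>"
    using assms by (simp add: word_prod_rev)
  then have cong: "cox_cong S (\<lambda>s t. ord (s \<otimes> t)) (rev vs @ us) []"
    using r assms(1) by (intro S_presents) (auto simp: in_lists_conv_set)
  have *: "foldr refl (rev vs) (foldr refl us v) = v" for v
    using cox_cong_refl_action[OF cong] by (simp flip: foldr_append add: fun_eq_iff)
  have "foldr refl vs (foldr refl (rev vs) u) = u" for u
    using foldr_refl_rev[OF r, of u] by simp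
  then show "foldr refl us = foldr refl vs"
    using * by (intro ext) metis
  have "even (length us) = even (length vs)" if "cox_cong S (\<lambda>s t. ord (s \<otimes> t)) us vs" for us vs
    using that by (induction rule: cox_cong.induct) (auto simp: length_concat sum_list_replicate)
  from this[OF cong] show "even (length us) = even (length vs)" by auto
qed

text \<open>No letters for inverses are needed, since generators are involutions.\<close>

lemma parabolic_words:
  assumes "J \<subseteq> S"
  shows "parabolic J = word_prod W ` lists J"
proof
  have JS: "lists J \<subseteq> lists S" using assms by (rule lists_mono)
  show "word_prod W ` lists J \<subseteq> parabolic J"
  proof (rule image_subsetI)
    fix ws assume "ws \<in> lists J"
    then show "word_prod W ws \<in> parabolic J"
      unfolding parabolic_def by (induction ws) (auto intro: generate.intros)
  qed
  show "parabolic J \<subseteq> word_prod W ` lists J"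
  proof
    fix w assume "w \<in> parabolic J"
    then show "w \<in> word_prod W ` lists J"
      unfolding parabolic_def
    proof (induction rule: generate.induct)
      case one
      show ?case by (intro image_eqI[of _ _ "[]"]) auto
    next
      case (incl h)
      then show ?case using assms S_carrier by (intro image_eqI[of _ _ "[h]"]) auto
    next
      case (inv h)
      then have "h \<in> S" using assms by auto
      with inv show ?case using S_carrier by (intro image_eqI[of _ _ "[h]"]) auto
    next
      case (eng h1 h2)
      then obtain us vs where "us \<in> lists J" "vs \<in> lists J" "h1 = word_prod W us" "h2 = word_prod W vs"
        by blast
      then show ?case using JS
        by (intro image_eqI[of _ _ "us @ vs"]) (simp_all add: subsetD)
    qed
  qed
qed

lemma carrier_words: "carrier W = word_prod W ` lists S"
  using parabolic_words[of S] S_generates by (simp add: parabolic_def)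

lemma word_exists:
  assumes "w \<in> carrier W"
  obtains ws where "ws \<in> lists S" "w = word_prod W ws"
  using assms unfolding carrier_words by blast

text \<open>The word picked by \<open>SOME\<close> has the same product as \<open>ws\<close>; from
  here on any convenient word computes the action.\<close>

lemma act_word: "ws \<in> lists S \<Longrightarrow> act (word_prod W ws) = foldr refl ws"
proof -
  assume ws: "ws \<in> lists S"
  define us where "us = (SOME us. us \<in> lists S \<and> word_prod W us = word_prod W ws)"
  have "us \<in> lists S \<and> word_prod W us = word_prod W ws"
    unfolding us_def by (rule someI[of _ ws]) (use ws in simp)
  then show ?thesis
    unfolding act_def us_def[symmetric] using ws by (intro words_same_product) auto
qed

lemma act_one [simp]: "act \<one> v = v"
  using act_word[of "[]"] by simp

lemma act_S: "s \<in> S \<Longrightarrow> act s = refl s"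
  using act_word[of "[s]"] S_carrier[of s] by (simp add: fun_eq_iff)

lemma act_mult: "w \<in> carrier W \<Longrightarrow> v \<in> carrier W \<Longrightarrow> act (w \<otimes> v) x = act w (act v x)"
proof -
  assume "w \<in> carrier W" "v \<in> carrier W"
  then obtain us vs where *: "us \<in> lists S" "vs \<in> lists S" "w = word_prod W us" "v = word_prod W vs"
    by (meson word_exists)
  then have wv: "w \<otimes> v = word_prod W (us @ vs)" by simp
  have "us @ vs \<in> lists S" using * by auto
  from act_word[OF this] show ?thesis
    using * unfolding wv by (simp add: act_word)
qed

lemma act_add: "w \<in> carrier W \<Longrightarrow> act w (u + v) = act w u + act w v"
  by (metis word_exists act_word foldr_refl_add)

lemma act_smul: "w \<in> carrier W \<Longrightarrow> act w (smul c v) = smul c (act w v)"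
  by (metis word_exists act_word foldr_refl_smul)

lemma act_minus: "w \<in> carrier W \<Longrightarrow> act w (- v) = - act w v"
  by (metis act_smul smul_minus_one)

lemma act_zero: "w \<in> carrier W \<Longrightarrow> act w 0 = 0"
  by (metis act_smul smul_simps(5))

lemma act_inv_act [simp]: "w \<in> carrier W \<Longrightarrow> act (inv w) (act w v) = v"
  by (simp flip: act_mult)

lemma act_act_inv [simp]: "w \<in> carrier W \<Longrightarrow> act w (act (inv w) v) = v"
  by (simp flip: act_mult)

lemma act_mult_S_alpha: "w \<in> carrier W \<Longrightarrow> s \<in> S \<Longrightarrow> act (w \<otimes> s) (\<alpha> s) = - act w (\<alpha> s)"
  by (simp add: act_mult S_carrier act_S refl_alpha act_minus)

lemma act_alpha_nonzero: "w \<in> carrier W \<Longrightarrow> act w (\<alpha> s) \<noteq> 0"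
  by (metis act_inv_act act_zero alpha_nonzero inv_closed)

lemma form_minus_one: "form u (- v) = - form u v" "form (- u) v = - form u v"
  using form_smul_right[of u "-1" v] form_smul_left[of "-1" u v] by (simp_all add: smul_minus_one)

lemma form_commute:
  assumes "Poly_Mapping.keys u \<subseteq> S" "Poly_Mapping.keys v \<subseteq> S"
  shows "form u v = form v u"
  unfolding form_def
  by (subst sum.swap) (intro sum.cong HOL.refl, use assms cos_form_commute in auto)

lemma keys_refl: "Poly_Mapping.keys v \<subseteq> J \<Longrightarrow> s \<in> J \<Longrightarrow> Poly_Mapping.keys (refl s v) \<subseteq> J"
  by (auto simp: refl_alt in_keys_iff lookup_add lookup_alpha split: if_splits)

lemma form_refl:
  assumes "s \<in> S" "Poly_Mapping.keys u \<subseteq> S"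
  shows "form (refl s u) (refl s v) = form u v"
proof -
  have "form u (\<alpha> s) = form (\<alpha> s) u" using assms by (intro form_commute) auto
  then show ?thesis using assms(1)
    by (simp add: refl_alt form_add_left form_add_right form_smul_left form_smul_right algebra_simps)
qed

lemma form_act:
  assumes "w \<in> carrier W" "Poly_Mapping.keys u \<subseteq> S"
  shows "form (act w u) (act w v) = form u v"
proof -
  \<comment> \<open>The support of the first argument is carried through the induction because
    \<open>cos_form\<close> is known to be symmetric only on \<open>S\<close>.\<close>
  have "form (foldr refl ws u) (foldr refl ws v) = form u v \<and> Poly_Mapping.keys (foldr refl ws u) \<subseteq> S"
    if "ws \<in> lists S" for ws
    using that by (induction ws) (use assms(2) in \<open>simp_all add: form_refl keys_refl\<close>)
  with assms(1) show ?thesis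
    by (metis word_exists act_word)
qed

lemma keys_act:
  assumes "J \<subseteq> S" "w \<in> parabolic J" "Poly_Mapping.keys v \<subseteq> J"
  shows "Poly_Mapping.keys (act w v) \<subseteq> J"
proof -
  have "Poly_Mapping.keys (foldr refl ws v) \<subseteq> J" if "ws \<in> lists J" for ws
    using that by (induction ws) (use assms in \<open>simp_all add: keys_refl\<close>)
  moreover obtain ws where "ws \<in> lists J" "w = word_prod W ws"
    using assms(2) unfolding parabolic_words[OF assms(1)] by blast
  moreover have "ws \<in> lists S"
    using lists_mono[OF assms(1)] \<open>ws \<in> lists J\<close> by blast
  ultimately show ?thesis by (simp add: act_word)
qed

subsection \<open>Length and positivity of roots\<close>

lemma len_le: "ws \<in> lists S \<Longrightarrow> len (word_prod W ws) \<le> length ws"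
  unfolding len_def by (rule Least_le) auto

lemma reduced_word:
  assumes "w \<in> carrier W"
  obtains ws where "ws \<in> lists S" "word_prod W ws = w" "length ws = len w"
proof -
  have "\<exists>n. \<exists>ws \<in> lists S. length ws = n \<and> word_prod W ws = w"
    using assms by (metis word_exists)
  from LeastI_ex[OF this] that show ?thesis unfolding len_def by metis
qed

lemma len_one [simp]: "len \<one> = 0"
  using len_le[of "[]"] by simp

lemma len_mult_le: "w \<in> carrier W \<Longrightarrow> v \<in> carrier W \<Longrightarrow> len (w \<otimes> v) \<le> len w + len v"
proof -
  assume "w \<in> carrier W" "v \<in> carrier W"
  then obtain us vs where *: "us \<in> lists S" "word_prod W us = w" "length us = len w"
    "vs \<in> lists S" "word_prod W vs = v" "length vs = len v"
    by (metis reduced_word)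
  then show ?thesis using len_le[of "us @ vs"] by simp
qed

lemma len_S_le: "s \<in> S \<Longrightarrow> len s \<le> 1"
  using len_le[of "[s]"] S_carrier[of s] by simp

lemma len_parity: "ws \<in> lists S \<Longrightarrow> even (len (word_prod W ws)) = even (length ws)"
  by (metis reduced_word word_prod_closed_S words_same_product(2))

text \<open>Length changes by at most one, and parity excludes equality.\<close>

lemma len_mult_S:
  assumes "w \<in> carrier W" "s \<in> S"
  shows "len (w \<otimes> s) = len w + 1 \<or> len w = len (w \<otimes> s) + 1"
proof -
  obtain ws where ws: "ws \<in> lists S" "w = word_prod W ws"
    using assms(1) by (rule word_exists)
  have "even (len (w \<otimes> s)) \<noteq> even (len w)"
    using len_parity[of "ws @ [s]"] len_parity[of ws] ws assms(2) S_carrier by simp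
  moreover have "len (w \<otimes> s) \<le> len w + 1"
    using len_mult_le[of w s] len_S_le[of s] assms S_carrier by fastforce
  moreover have "len w \<le> len (w \<otimes> s) + 1"
    using len_mult_le[of "w \<otimes> s" s] len_S_le[of s] assms S_carrier by fastforce
  ultimately show ?thesis by (metis le_antisym not_less_eq_eq Suc_eq_plus1 le_Suc_eq)
qed

lemma len_inv: "w \<in> carrier W \<Longrightarrow> len (inv w) = len w"
proof -
  have "len (inv w) \<le> len w" if w: "w \<in> carrier W" for w
  proof -
    obtain ws where ws: "ws \<in> lists S" "word_prod W ws = w" "length ws = len w"
      using w by (rule reduced_word)
    then have "rev ws \<in> lists S" by (auto simp: in_lists_conv_set)
    from len_le[OF this] show ?thesis using ws by (simp add: word_prod_rev)
  qed
  then show "w \<in> carrier W \<Longrightarrow> len (inv w) = len w"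
    by (metis inv_closed inv_inv le_antisym)
qed

lemma last_letter:
  assumes "w \<in> carrier W" "w \<noteq> \<one>"
  obtains s where "s \<in> S" "len (w \<otimes> s) < len w"
proof -
  obtain ws where ws: "ws \<in> lists S" "word_prod W ws = w" "length ws = len w"
    using assms(1) by (rule reduced_word)
  then have "ws \<noteq> []" using assms by auto
  then obtain us s where us: "ws = us @ [s]" by (metis append_butlast_last_id)
  then have "us \<in> lists S" "s \<in> S" using ws by auto
  moreover from this have "w \<otimes> s = word_prod W us"
    unfolding ws(2)[symmetric] us by (simp add: S_carrier m_assoc)
  ultimately show ?thesis using that len_le[of us] ws us by auto
qed

section \<open>Dihedral subgroups and the positivity of roots\<close>

text \<open>The last letter, not the first, is fixed: the action applies it first, and factors of w
  are split off on the right. The first letter therefore depends on the parity of the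
  length.\<close>

fun alternating :: "'a \<Rightarrow> 'a \<Rightarrow> nat \<Rightarrow> 'a list" where
  "alternating s t 0 = []"
| "alternating s t (Suc k) = alternating t s k @ [t]"

lemma alternating_Cons:
  "alternating s t (Suc k) = (if even k then t else s) # alternating s t k"
  by (induction k arbitrary: s t) auto

lemma length_alternating [simp]: "length (alternating s t k) = k"
  by (induction s t k rule: alternating.induct) auto

lemma alternating_lists: "s \<in> J \<Longrightarrow> t \<in> J \<Longrightarrow> alternating s t k \<in> lists J"
  by (induction s t k rule: alternating.induct) auto

lemma alternating_prefix:
  assumes "s \<in> S" "t \<in> S"
  shows "\<exists>zs. zs \<in> lists S \<and> length zs = i \<and> alternating s t (i + j) = zs @ alternating s t j"
proof (induction i)
  case (Suc i)
  then obtain zs where "zs \<in> lists S \<and> length zs = i \<and> alternating s t (i + j) = zs @ alternating s t j"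
    by blast
  then show ?case
    using assms alternating_Cons[of s t "i + j"]
    by (intro exI[of _ "(if even (i + j) then t else s) # zs"]) simp
qed simp

text \<open>Stripping the last letters of both words turns s (t s)^j t into (s t)^(j+1) and swaps
  the roles of s and t. The power in the middle is the accumulator that makes the induction close,
  with j + k kept constant; the braid relation is the case j = 0.\<close>

lemma alternating_quotient:
  assumes "s \<in> S" "t \<in> S"
    and "(s \<otimes> t) [^] (j + k) = \<one>" "(t \<otimes> s) [^] (j + k) = \<one>"
  shows "word_prod W (alternating t s k) \<otimes> (t \<otimes> s) [^] j
    \<otimes> inv (word_prod W (alternating s t k)) = \<one>"
  using assms
proof (induction k arbitrary: s t j)
  case (Suc k)
  let ?p = "word_prod W (alternating t s k)" and ?q = "word_prod W (alternating s t k)"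
  have [simp]: "?p \<in> carrier W" "?q \<in> carrier W" "s \<in> carrier W" "t \<in> carrier W"
    "alternating s t k \<in> lists S" "alternating t s k \<in> lists S"
    using Suc.prems S_carrier alternating_lists by auto
  have comm: "s \<otimes> (t \<otimes> s) [^] j \<otimes> t = (s \<otimes> t) [^] Suc j" for j :: nat
  proof (induction j)
    case (Suc j)
    have "s \<otimes> (t \<otimes> s) [^] Suc j \<otimes> t = (s \<otimes> (t \<otimes> s) [^] j \<otimes> t) \<otimes> (s \<otimes> t)"
      by (simp add: m_assoc)
    then show ?case by (simp only: Suc) simp
  qed simp
  have "?q \<otimes> s \<otimes> (t \<otimes> s) [^] j \<otimes> inv (?p \<otimes> t) = ?q \<otimes> (s \<otimes> (t \<otimes> s) [^] j \<otimes> t) \<otimes> inv ?p"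
    using Suc.prems by (simp add: inv_mult_group m_assoc)
  also have "\<dots> = ?q \<otimes> (s \<otimes> t) [^] Suc j \<otimes> inv ?p"
    by (simp only: comm)
  also have "\<dots> = \<one>"
    using Suc.IH[of t s "Suc j"] Suc.prems by simp
  finally show ?case using Suc.prems by simp
qed simp

lemma braid_relation:
  assumes "s \<in> S" "t \<in> S"
  shows "word_prod W (alternating s t (m s t)) = word_prod W (alternating t s (m s t))"
proof -
  have "(s \<otimes> t) [^] m s t = \<one>" "(t \<otimes> s) [^] m s t = \<one>"
    using assms S_carrier pow_ord_eq_1 m_commute[OF assms] by (metis m_def m_closed)+
  from alternating_quotient[OF assms, of 0 "m s t"] this
  have "word_prod W (alternating t s (m s t)) \<otimes> inv (word_prod W (alternating s t (m s t))) = \<one>"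
    using assms alternating_lists[of s S t] alternating_lists[of t S s] by simp
  then show ?thesis
    using assms alternating_lists[of s S t] alternating_lists[of t S s]
    by (metis inv_equality inv_inv inv_closed word_prod_closed_S)
qed

text \<open>Each letter moves the pair of consecutive coefficients one place along the recurrence
  and swaps the two simple roots. The unordered pair {x, y} hides the resulting dependence on
  parity, and an abstract sequence treats finite and infinite order together.\<close>

lemma refl_alternating:
  assumes "s \<in> S" "t \<in> S"
    and a: "\<And>i. a (Suc (Suc i)) = - 2 * cos_form s t * a (Suc i) - a i"
  shows "\<exists>x y. {x, y} = {s, t} \<and>
    foldr refl (alternating s t k) (smul (a (Suc j)) (\<alpha> s) + smul (a j) (\<alpha> t))
      = smul (a (Suc (j + k))) (\<alpha> x) + smul (a (j + k)) (\<alpha> y)"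
  using assms
proof (induction k arbitrary: s t j)
  case (Suc k)
  have c: "cos_form t s = cos_form s t" using Suc.prems cos_form_commute by metis
  have "refl t (smul (a (Suc j)) (\<alpha> s) + smul (a j) (\<alpha> t))
    = smul (a (Suc (Suc j))) (\<alpha> t) + smul (a (Suc j)) (\<alpha> s)"
    unfolding Suc.prems(3)
    by (rule poly_mapping_eqI)
      (simp add: refl_alt lookup_add form_add_right form_smul_right Suc.prems(1,2) c algebra_simps)
  moreover obtain x y where "{x, y} = {t, s}"
    "foldr refl (alternating t s k) (smul (a (Suc (Suc j))) (\<alpha> t) + smul (a (Suc j)) (\<alpha> s))
      = smul (a (Suc (Suc j + k))) (\<alpha> x) + smul (a (Suc j + k)) (\<alpha> y)"
    using Suc.IH[of t s "Suc j"] Suc.prems c by auto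
  ultimately show ?case by (intro exI[of _ x] exI[of _ y]) auto
qed auto

text \<open>For finite order these are the quotients sin(i \<theta>) / sin \<theta> with \<theta> =
  pi / m, nonnegative as long as i \<theta> stays within [0, pi]. For infinite order the recurrence
  has the solution i, the limit of these quotients as \<theta> tends to 0.\<close>

lemma dihedral_coefficients:
  assumes "s \<in> S" "t \<in> S" "s \<noteq> t"
  obtains a :: "nat \<Rightarrow> real" where "a 0 = 0" "a 1 = 1"
    "\<And>i. a (Suc (Suc i)) = - 2 * cos_form s t * a (Suc i) - a i"
    "\<And>i. m s t = 0 \<or> i \<le> m s t \<Longrightarrow> a i \<ge> 0"
proof (cases "m s t = 0")
  case True
  then show ?thesis by (intro that[of real]) (simp_all add: cos_form_def)
next
  case False
  define \<theta> where "\<theta> = pi / real (m s t)"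
  have m2: "m s t \<ge> 2" using False m_eq_1_iff[OF assms(1,2)] assms(3) by linarith
  have sin_pos: "sin \<theta> > 0"
    using m2 by (intro sin_gt_zero) (auto simp: \<theta>_def field_simps)
  show ?thesis
  proof (rule that[of "\<lambda>i. sin (real i * \<theta>) / sin \<theta>"])
    fix i
    have c: "cos_form s t = - cos \<theta>" using False by (simp add: cos_form_def \<theta>_def)
    have "sin (real (Suc (Suc i)) * \<theta>) = 2 * cos \<theta> * sin (real (Suc i) * \<theta>) - sin (real i * \<theta>)"
      using sin_add_two[of "real i" \<theta>] by (simp add: add.commute)
    then show "sin (real (Suc (Suc i)) * \<theta>) / sin \<theta>
      = - 2 * cos_form s t * (sin (real (Suc i) * \<theta>) / sin \<theta>) - sin (real i * \<theta>) / sin \<theta>"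
      unfolding c by (simp only: diff_divide_distrib) simp
  next
    fix i assume "m s t = 0 \<or> i \<le> m s t"
    then have "real i * \<theta> \<le> pi" using m2 by (simp add: \<theta>_def field_simps)
    then have "sin (real i * \<theta>) \<ge> 0" by (intro sin_ge_zero) (simp_all add: \<theta>_def)
    then show "sin (real i * \<theta>) / sin \<theta> \<ge> 0" using sin_pos by simp
  qed (use sin_pos in simp_all)
qed

text \<open>Induction on the length: \<open>w\<close> is written as \<open>v a\<close> with \<open>a\<close> in the dihedral group generated by \<open>s\<close>
  and the last letter \<open>t\<close> of a reduced word for \<open>w\<close>, the length of \<open>a\<close> being maximal subject to
  additivity of lengths.  Then \<open>v\<close> maps \<open>\<alpha>\<^sub>s\<close> and \<open>\<alpha>\<^sub>t\<close> to nonnegative vectors, and \<open>a \<alpha>\<^sub>s\<close> is a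
  nonnegative combination of \<open>\<alpha>\<^sub>s\<close> and \<open>\<alpha>\<^sub>t\<close>.\<close>

theorem nonneg_act_alpha:
  assumes "w \<in> carrier W" "s \<in> S" "len (w \<otimes> s) > len w"
  shows "nonneg (act w (\<alpha> s))"
  using assms
proof (induction "len w" arbitrary: w s rule: less_induct)
  case less
  show ?case
  proof (cases "w = \<one>")
    case True
    then show ?thesis by (simp add: nonneg_alpha)
  next
    case False
    then obtain t where t: "t \<in> S" "len (w \<otimes> t) < len w"
      using less.prems last_letter by metis
    note s = \<open>s \<in> S\<close> and w = \<open>w \<in> carrier W\<close>
    have "s \<noteq> t" using t less.prems by auto
    let ?a = "alternating s t"
    define P where "P k \<longleftrightarrow> (\<exists>v\<in>carrier W. w = v \<otimes> word_prod W (?a k) \<and> len v + k = len w)" for k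
    have aS [simp]: "?a k \<in> lists S" "alternating t s k \<in> lists S" for k
      using s t alternating_lists by auto
    have [simp]: "s \<in> carrier W" "t \<in> carrier W" using s t S_carrier by auto
    \<comment> \<open>The descent t provides a factorisation with k = 1, so the maximal k is
      positive and v is strictly shorter than w, as the induction hypothesis requires.\<close>
    have "P 1"
      unfolding P_def using w t len_mult_S[OF w t(1)]
      by (intro bexI[of _ "w \<otimes> t"]) simp_all
    moreover have Ple: "\<forall>k. P k \<longrightarrow> k \<le> len w"
      unfolding P_def by auto
    ultimately obtain k where k: "P k" "\<And>i. P i \<Longrightarrow> i \<le> k" "k \<ge> 1"
      by (metis Greatest_le_nat GreatestI_nat)
    then obtain v where v: "v \<in> carrier W" "w = v \<otimes> word_prod W (?a k)" "len v + k = len w"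
      unfolding P_def by blast
    \<comment> \<open>For k >= 1, y is the first letter of the alternating word of length k, and x
      is the letter that would prolong it on the left. A descent of v at x would contradict the
      maximality of k; a descent at y would give w an expression shorter than its length.\<close>
    define x y where "x = (if even k then t else s)" and "y = (if even k then s else t)"
    have xy: "{x, y} = {s, t}" "x \<in> S" "y \<in> S" using s t by (auto simp: x_def y_def)
    then have [simp]: "x \<in> carrier W" "y \<in> carrier W" using S_carrier by auto
    have "len (v \<otimes> x) > len v"
    proof (rule ccontr)
      assume "\<not> len (v \<otimes> x) > len v"
      then have "len (v \<otimes> x) + Suc k = len w"
        using len_mult_S[OF v(1) xy(2)] v(3) by auto
      moreover have "w = v \<otimes> x \<otimes> word_prod W (?a (Suc k))"
        unfolding alternating_Cons x_def[symmetric] using v xy by (simp add: m_assoc)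
      ultimately have "P (Suc k)" unfolding P_def using v by auto
      then show False using k(2) by fastforce
    qed
    moreover have "len (v \<otimes> y) > len v"
    proof (rule ccontr)
      assume "\<not> len (v \<otimes> y) > len v"
      then have "len (v \<otimes> y) + 1 = len v"
        using len_mult_S[OF v(1) xy(3)] by auto
      obtain i where i: "k = Suc i" using k(3) by (cases k) auto
      have "w = v \<otimes> y \<otimes> word_prod W (?a i)"
        using v xy unfolding i alternating_Cons by (simp add: i y_def m_assoc)
      then have "len w \<le> len (v \<otimes> y) + len (word_prod W (?a i))"
        using len_mult_le[of "v \<otimes> y" "word_prod W (?a i)"] v by simp
      also have "\<dots> \<le> len (v \<otimes> y) + i"
        using len_le[of "?a i"] by simp
      finally show False using \<open>len (v \<otimes> y) + 1 = len v\<close> v(3) i by linarith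
    qed
    ultimately have vxy: "nonneg (act v (\<alpha> x))" "nonneg (act v (\<alpha> y))"
      using less.hyps[of v] v k(3) xy by auto
    \<comment> \<open>Otherwise the braid relation rewrites the last m letters so that they end in
      s, and multiplying by s shortens w. The strict bound keeps \<open>Suc k\<close> in the range
      where the coefficients are nonnegative.\<close>
    have "k < m s t" if m0: "m s t \<noteq> 0"
    proof (rule ccontr)
      assume "\<not> k < m s t"
      then obtain i where i: "k = i + m s t" by (metis add.commute le_add_diff_inverse not_less)
      obtain j where j: "m s t = Suc j" using m0 by (cases "m s t") auto
      obtain zs where zs: "zs \<in> lists S" "length zs = i" "?a (i + m s t) = zs @ ?a (m s t)"
        using alternating_prefix[OF s t(1)] by blast
      have "w = v \<otimes> word_prod W zs \<otimes> word_prod W (alternating t s (m s t))"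
        using v(1,2) zs by (simp add: i m_assoc braid_relation[OF s t(1)])
      also have "alternating t s (m s t) = ?a j @ [s]" by (simp add: j)
      finally have "w \<otimes> s = v \<otimes> word_prod W (zs @ ?a j)"
        using v zs s by (simp add: m_assoc)
      then have "len (w \<otimes> s) \<le> len v + len (word_prod W (zs @ ?a j))"
        using len_mult_le[of v "word_prod W (zs @ ?a j)"] v zs by simp
      also have "\<dots> \<le> len v + (i + j)"
        using len_le[of "zs @ ?a j"] zs by simp
      finally show False using v(3) less.prems(3) i j by linarith
    qed
    then have km: "m s t = 0 \<or> Suc k \<le> m s t" using Suc_leI by blast
    obtain a :: "nat \<Rightarrow> real" where a: "a 0 = 0" "a 1 = 1"
      "\<And>i. a (Suc (Suc i)) = - 2 * cos_form s t * a (Suc i) - a i"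
      "\<And>i. m s t = 0 \<or> i \<le> m s t \<Longrightarrow> a i \<ge> 0"
      using dihedral_coefficients[OF s t(1) \<open>s \<noteq> t\<close>] by blast
    obtain x' y' where xy': "{x', y'} = {s, t}"
      "foldr refl (?a k) (smul (a (Suc 0)) (\<alpha> s) + smul (a 0) (\<alpha> t))
        = smul (a (Suc (0 + k))) (\<alpha> x') + smul (a (0 + k)) (\<alpha> y')"
      using refl_alternating[where a = a and k = k and j = 0, OF s t(1) a(3)] by blast
    have "act w (\<alpha> s) = act v (act (word_prod W (?a k)) (\<alpha> s))"
      using v by (simp add: act_mult)
    also have "act (word_prod W (?a k)) (\<alpha> s) = smul (a (Suc k)) (\<alpha> x') + smul (a k) (\<alpha> y')"
      using xy'(2) a(1,2) by (simp add: act_word smul_simps)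
    finally have "act w (\<alpha> s) = smul (a (Suc k)) (act v (\<alpha> x')) + smul (a k) (act v (\<alpha> y'))"
      using v by (simp add: act_add act_smul)
    moreover have "nonneg (act v (\<alpha> x'))" "nonneg (act v (\<alpha> y'))"
      using vxy xy(1) xy'(1) by (auto simp: doubleton_eq_iff)
    moreover have "a (Suc k) \<ge> 0" "a k \<ge> 0"
      using a(4) km by auto
    ultimately show ?thesis by (simp add: nonneg_add nonneg_smul)
  qed
qed

section \<open>The sign test and the exchange condition\<close>

lemma nonneg_or_nonpos_act_alpha:
  assumes "w \<in> carrier W" "s \<in> S"
  shows "nonneg (act w (\<alpha> s)) \<or> nonneg (- act w (\<alpha> s))"
proof (cases "len (w \<otimes> s) > len w")
  case True
  then show ?thesis using nonneg_act_alpha assms by blast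
next
  case False
  then have "len (w \<otimes> s \<otimes> s) > len (w \<otimes> s)" using len_mult_S[OF assms] assms by auto
  then have "nonneg (act (w \<otimes> s) (\<alpha> s))"
    using assms S_carrier by (intro nonneg_act_alpha) auto
  then show ?thesis using assms by (simp add: act_mult_S_alpha)
qed

lemma not_nonneg_and_nonpos_act_alpha:
  assumes "w \<in> carrier W" "nonneg (act w (\<alpha> s))"
  shows "\<not> nonneg (- act w (\<alpha> s))"
  using assms nonneg_antisym act_alpha_nonzero by blast

lemma len_mult_S_less_iff:
  assumes "w \<in> carrier W" "s \<in> S"
  shows "len (w \<otimes> s) < len w \<longleftrightarrow> nonneg (- act w (\<alpha> s))"
proof
  assume "len (w \<otimes> s) < len w"
  then have "nonneg (act (w \<otimes> s) (\<alpha> s))"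
    using assms S_carrier by (intro nonneg_act_alpha) auto
  then show "nonneg (- act w (\<alpha> s))" using assms by (simp add: act_mult_S_alpha)
next
  assume "nonneg (- act w (\<alpha> s))"
  then have "\<not> len (w \<otimes> s) > len w"
    using not_nonneg_and_nonpos_act_alpha nonneg_act_alpha assms by blast
  then show "len (w \<otimes> s) < len w" using len_mult_S[OF assms] by auto
qed

text \<open>A nontrivial element has a descent, and a descent sends its simple root to a nonpositive
  vector. This is faithfulness of the representation in the form in which it is applied.\<close>

lemma eq_one_if_nonneg:
  assumes "w \<in> carrier W" "\<And>s. s \<in> S \<Longrightarrow> nonneg (act w (\<alpha> s))"
  shows "w = \<one>"
  using last_letter[OF assms(1)] len_mult_S_less_iff assms not_nonneg_and_nonpos_act_alpha by metis

text \<open>The element w s w^-1 acts as the reflection in \<alpha>_t. Its product u with t fixes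
  \<alpha>_t and changes any other \<alpha>_r only by a multiple of \<alpha>_t, so the coefficient
  at r remains 1. A root with a positive coefficient is nonnegative, and the sign test gives u =
  1.\<close>

lemma conj_S_eq:
  assumes "w \<in> carrier W" "s \<in> S" "t \<in> S" "act w (\<alpha> s) = \<alpha> t"
  shows "w \<otimes> s \<otimes> inv w = t"
proof -
  note [simp] = assms(1-3) S_carrier[OF assms(2)] S_carrier[OF assms(3)]
  define u where "u = w \<otimes> s \<otimes> inv w \<otimes> t"
  have u: "u \<in> carrier W" by (simp add: u_def)
  have conj: "act (w \<otimes> s \<otimes> inv w) v = v + smul (- 2 * form (\<alpha> s) (act (inv w) v)) (\<alpha> t)" for v
    by (simp add: act_mult act_S refl_alt act_add act_smul assms(4))
  have "inv w \<in> carrier W" by simp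
  then have st: "act (inv w) (\<alpha> t) = \<alpha> s" using assms(4) act_inv_act[of w "\<alpha> s"] by simp
  have ut: "act u (\<alpha> t) = \<alpha> t"
    by (simp add: u_def act_mult act_S refl_alpha act_minus st) (simp add: assms(4))
  have "nonneg (act u (\<alpha> r))" if r: "r \<in> S" for r
  proof (cases "r = t")
    case True
    then show ?thesis by (simp add: ut nonneg_alpha)
  next
    case False
    obtain c where "act u (\<alpha> r) = \<alpha> r + smul c (\<alpha> t)"
    proof
      define b where "b = - 2 * form (\<alpha> t) (\<alpha> r)"
      have "act u (\<alpha> r) = act (w \<otimes> s \<otimes> inv w) (\<alpha> r + smul b (\<alpha> t))"
        by (simp add: u_def act_mult act_S refl_alt b_def)
      also have "\<dots> = \<alpha> r + smul (b - 2 * form (\<alpha> s) (act (inv w) (\<alpha> r + smul b (\<alpha> t)))) (\<alpha> t)"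
        unfolding conj by (rule poly_mapping_eqI) (simp add: lookup_add algebra_simps)
      finally show "act u (\<alpha> r) = \<alpha> r + smul (b - 2 * form (\<alpha> s) (act (inv w) (\<alpha> r + smul b (\<alpha> t)))) (\<alpha> t)" .
    qed
    then have "Poly_Mapping.lookup (act u (\<alpha> r)) r = 1"
      using False by (simp add: lookup_add lookup_alpha)
    then have "\<not> nonneg (- act u (\<alpha> r))"
      unfolding nonneg_def by (auto intro!: exI[of _ r])
    then show ?thesis using nonneg_or_nonpos_act_alpha[OF u r] by blast
  qed
  then have "u = \<one>" by (rule eq_one_if_nonneg[OF u])
  then show ?thesis
    unfolding u_def using inv_equality[of "w \<otimes> s \<otimes> inv w" t] by simp
qed

text \<open>The letter to delete is the one at which the image b of \<alpha>_s changes sign. The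
  reflection in t alters only the coefficient at t, so b is a multiple of \<alpha>_t, and invariance
  of the form makes it \<alpha>_t itself. Then \<open>conj_S_eq\<close> says that multiplying by s
  on the right cancels t.\<close>

lemma exchange:
  assumes "ws \<in> lists S" "s \<in> S" "\<not> nonneg (act (word_prod W ws) (\<alpha> s))"
  shows "\<exists>us t vs. ws = us @ t # vs \<and> word_prod W (us @ vs) = word_prod W ws \<otimes> s"
  using assms
proof (induction ws)
  case Nil
  then show ?case by (simp add: nonneg_alpha)
next
  case (Cons t vs)
  note [simp] = S_carrier[OF \<open>s \<in> S\<close>] \<open>s \<in> S\<close>
  have t: "t \<in> S" "vs \<in> lists S" using Cons.hyps by simp_all
  note [simp] = S_carrier[OF t(1)] t
  show ?case
  proof (cases "nonneg (act (word_prod W vs) (\<alpha> s))")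
    case False
    then obtain us x vs' where *: "vs = us @ x # vs'" "word_prod W (us @ vs') = word_prod W vs \<otimes> s"
      using Cons by auto
    have "word_prod W (t # us @ vs') = word_prod W (t # vs) \<otimes> s"
      unfolding word_prod_Cons *(2) by (simp add: m_assoc)
    then show ?thesis using * by (intro exI[of _ "t # us"] exI[of _ x] exI[of _ vs']) simp
  next
    case True
    define b where "b = act (word_prod W vs) (\<alpha> s)"
    have "act (word_prod W (t # vs)) (\<alpha> s) = refl t b"
      by (simp add: b_def act_mult act_S)
    then have neg: "nonneg (- refl t b)"
      using nonneg_or_nonpos_act_alpha[of "word_prod W (t # vs)" s] Cons.prems by auto
    have "b = smul (Poly_Mapping.lookup b t) (\<alpha> t)"
    proof (rule poly_mapping_eqI)
      fix k
      have "Poly_Mapping.lookup b k \<ge> 0" "- Poly_Mapping.lookup (refl t b) k \<ge> 0"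
        using True neg unfolding b_def nonneg_def by auto
      then show "Poly_Mapping.lookup b k = Poly_Mapping.lookup (smul (Poly_Mapping.lookup b t) (\<alpha> t)) k"
        by (auto simp: refl_alt lookup_add lookup_alpha)
    qed
    then obtain c where c: "b = smul c (\<alpha> t)" by blast
    have "c \<ge> 0" using True by (auto simp: b_def[symmetric] c nonneg_def lookup_alpha dest: spec[of _ t])
    have "form b b = 1"
      unfolding b_def by (subst form_act) auto
    then have "c * c = 1" by (simp add: c form_smul_left form_smul_right)
    then have "c = 1" using \<open>c \<ge> 0\<close> by (metis abs_of_nonneg abs_1 abs_mult_self_eq real_sqrt_abs2 real_sqrt_one)
    then have "word_prod W vs \<otimes> s \<otimes> inv (word_prod W vs) = t"
      using c by (intro conj_S_eq) (auto simp: b_def smul_simps)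
    then have "t \<otimes> (word_prod W vs \<otimes> s \<otimes> inv (word_prod W vs) \<otimes> word_prod W vs) = t \<otimes> (t \<otimes> word_prod W vs)"
      by simp
    then have "word_prod W vs = word_prod W (t # vs) \<otimes> s"
      by (simp add: m_assoc)
    then show ?thesis by (intro exI[of _ "[]"] exI[of _ t] exI[of _ vs]) simp
  qed
qed

subsection \<open>Longest elements of parabolic subgroups\<close>

lemma parabolic_subgroup: "J \<subseteq> S \<Longrightarrow> subgroup (parabolic J) W"
  unfolding parabolic_def using S_subset by (intro generate_is_subgroup) auto

lemma parabolic_carrier: "J \<subseteq> S \<Longrightarrow> w \<in> parabolic J \<Longrightarrow> w \<in> carrier W"
  by (rule subgroup.mem_carrier[OF parabolic_subgroup])

lemma parabolic_mult: "J \<subseteq> S \<Longrightarrow> w \<in> parabolic J \<Longrightarrow> v \<in> parabolic J \<Longrightarrow> w \<otimes> v \<in> parabolic J"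
  by (rule subgroup.m_closed[OF parabolic_subgroup])

lemma parabolic_inv: "J \<subseteq> S \<Longrightarrow> w \<in> parabolic J \<Longrightarrow> inv w \<in> parabolic J"
  by (rule subgroup.m_inv_closed[OF parabolic_subgroup])

lemma parabolic_incl: "s \<in> J \<Longrightarrow> s \<in> parabolic J"
  unfolding parabolic_def by (rule generate.incl)

lemma parabolic_mono: "J \<subseteq> K \<Longrightarrow> parabolic J \<subseteq> parabolic K"
  unfolding parabolic_def by (rule mono_generate)

lemma finite_type_mono: "J \<subseteq> K \<Longrightarrow> finite_type K \<Longrightarrow> finite_type J"
  unfolding finite_type_def by (rule finite_subset[OF parabolic_mono])

text \<open>The length \<open>len\<close> refers to words over all of \<open>S\<close>, so a
  shortest word over J is taken instead. If it ended in s, its remaining prefix would make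
  \<alpha>_s negative; exchange then deletes a letter of that prefix and yields a shorter word,
  still over J.\<close>

lemma eq_one_if_nonneg_parabolic:
  assumes J: "J \<subseteq> S" and u: "u \<in> parabolic J"
    and nonneg: "\<And>s. s \<in> J \<Longrightarrow> nonneg (act u (\<alpha> s))"
  shows "u = \<one>"
proof -
  define P where "P ws \<longleftrightarrow> ws \<in> lists J \<and> word_prod W ws = u" for ws
  have "\<exists>ws. P ws" using u unfolding P_def parabolic_words[OF J] by auto
  then obtain ws where ws: "P ws" "\<And>vs. P vs \<Longrightarrow> length ws \<le> length vs"
    using ex_has_least_nat[of P _ length] by blast
  show ?thesis
  proof (cases ws rule: rev_cases)
    case Nil
    then show ?thesis using ws by (auto simp: P_def)
  next
    case (snoc us s)
    have us: "us \<in> lists J" "s \<in> J" using ws snoc by (auto simp: P_def)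
    then have S: "us \<in> lists S" "s \<in> S" using J lists_mono[OF J] by auto
    have "u = word_prod W us \<otimes> s"
      using ws(1) S S_carrier by (simp add: P_def snoc)
    then have "act u (\<alpha> s) = - act (word_prod W us) (\<alpha> s)"
      using S by (simp add: act_mult_S_alpha)
    then have "\<not> nonneg (act (word_prod W us) (\<alpha> s))"
      using nonneg[OF us(2)] not_nonneg_and_nonpos_act_alpha[of "word_prod W us" s] S by auto
    from exchange[OF S this] obtain as t bs where *: "us = as @ t # bs"
      "word_prod W (as @ bs) = word_prod W us \<otimes> s" by blast
    then have "P (as @ bs)" using us \<open>u = _\<close> by (auto simp: P_def)
    from ws(2)[OF this] show ?thesis using * snoc by simp
  qed
qed

lemma act_sum: "w \<in> carrier W \<Longrightarrow> act w (sum f F) = (\<Sum>i\<in>F. act w (f i))"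
  by (induction F rule: infinite_finite_induct) (simp_all add: act_zero act_add)

lemma nonpos_act:
  assumes w: "w \<in> carrier W" and nonpos: "\<And>s. s \<in> J \<Longrightarrow> nonneg (- act w (\<alpha> s))"
    and v: "nonneg v" "Poly_Mapping.keys v \<subseteq> J"
  shows "nonneg (- act w v)"
proof -
  have "act w v = (\<Sum>s\<in>Poly_Mapping.keys v. smul (Poly_Mapping.lookup v s) (act w (\<alpha> s)))"
    by (subst poly_mapping_eq_sum_single[of v]) (simp add: act_sum[OF w] smul_alpha act_smul[OF w])
  moreover have "nonneg (- smul (Poly_Mapping.lookup v s) (act w (\<alpha> s)))"
    if "s \<in> Poly_Mapping.keys v" for s
    using nonpos[of s] v that by (auto simp: nonneg_def mult_le_0_iff)
  ultimately show ?thesis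
    by (auto simp: nonneg_def lookup_sum intro!: sum_nonpos)
qed

context
  fixes J assumes J: "J \<subseteq> S" and fin: "finite_type J"
begin

lemma nonpos_if_longest:
  assumes "w \<in> parabolic J" "\<forall>v \<in> parabolic J. len v \<le> len w" "s \<in> J"
  shows "nonneg (- act w (\<alpha> s))"
proof -
  have s: "s \<in> S" and w: "w \<in> carrier W" using assms J parabolic_carrier by auto
  have "len (w \<otimes> s) \<le> len w"
    using assms parabolic_mult[OF J] parabolic_incl by blast
  then show ?thesis
    using len_mult_S[OF w s] by (auto simp flip: len_mult_S_less_iff[OF w s])
qed

text \<open>The inverse of w is longest as well, so it negates simple roots of J. It therefore makes
  the nonpositive images under u nonnegative again, and the relative sign test applies to w^-1
  u.\<close>

lemma longest_unique:
  assumes w: "w \<in> parabolic J" "\<forall>v \<in> parabolic J. len v \<le> len w"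
    and u: "u \<in> parabolic J" "\<And>s. s \<in> J \<Longrightarrow> nonneg (- act u (\<alpha> s))"
  shows "u = w"
proof -
  note [simp] = parabolic_carrier[OF J w(1)] parabolic_carrier[OF J u(1)]
  have inv_w: "inv w \<in> parabolic J" "\<forall>v \<in> parabolic J. len v \<le> len (inv w)"
    using w parabolic_inv[OF J] by (auto simp: len_inv)
  have "inv w \<otimes> u = \<one>"
  proof (rule eq_one_if_nonneg_parabolic[OF J])
    show "inv w \<otimes> u \<in> parabolic J" using inv_w u parabolic_mult[OF J] by blast
    fix s assume s: "s \<in> J"
    have "Poly_Mapping.keys (act u (\<alpha> s)) \<subseteq> J"
      by (rule keys_act[OF J u(1)]) (simp add: s)
    then have "Poly_Mapping.keys (- act u (\<alpha> s)) \<subseteq> J"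
      by (auto simp: in_keys_iff)
    then have "nonneg (- act (inv w) (- act u (\<alpha> s)))"
      using nonpos_if_longest[OF inv_w] u(2)[OF s] by - (rule nonpos_act[where J = J], simp_all)
    then show "nonneg (act (inv w \<otimes> u) (\<alpha> s))"
      by (simp add: act_mult act_minus)
  qed
  then show ?thesis using inv_equality[of "inv w" u] by (metis inv_closed inv_inv parabolic_carrier[OF J w(1)] parabolic_carrier[OF J u(1)])
qed

lemma w0_longest: "w0 J \<in> parabolic J \<and> (\<forall>v \<in> parabolic J. len v \<le> len (w0 J))"
proof -
  have "finite (len ` parabolic J)" "len ` parabolic J \<noteq> {}"
    using fin parabolic_subgroup[OF J] subgroup.one_closed by (auto simp: finite_type_def)
  then obtain w where w: "w \<in> parabolic J" "len w = Max (len ` parabolic J)"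
    by (metis Max_in imageE)
  then have "\<forall>v \<in> parabolic J. len v \<le> len w"
    using fin by (simp add: finite_type_def)
  then have "\<exists>!w. w \<in> parabolic J \<and> (\<forall>v \<in> parabolic J. len v \<le> len w)"
    using w(1) longest_unique nonpos_if_longest by (intro ex1I[of _ w]) blast+
  then show ?thesis unfolding w0_def by (rule theI')
qed

lemma w0_parabolic: "w0 J \<in> parabolic J"
  using w0_longest by blast

lemma w0_carrier [simp]: "w0 J \<in> carrier W"
  using parabolic_carrier[OF J w0_parabolic] .

text \<open>Longest elements are recognised by signs from here on, without computing
  lengths.\<close>

lemma w0_eqI: "u \<in> parabolic J \<Longrightarrow> (\<And>s. s \<in> J \<Longrightarrow> nonneg (- act u (\<alpha> s))) \<Longrightarrow> w0 J = u"
  using longest_unique[of "w0 J" u] w0_longest by metis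

lemma w0_inv [simp]: "inv (w0 J) = w0 J"
proof -
  have "inv (w0 J) \<in> parabolic J" "\<forall>v \<in> parabolic J. len v \<le> len (inv (w0 J))"
    using w0_longest parabolic_inv[OF J] by (auto simp: len_inv)
  then show ?thesis using nonpos_if_longest w0_eqI by metis
qed

lemma w0_square [simp]: "w0 J \<otimes> w0 J = \<one>"
  using l_inv[OF w0_carrier] by simp

lemma act_w0_act_w0 [simp]: "act (w0 J) (act (w0 J) v) = v"
  using act_inv_act[OF w0_carrier] by simp

text \<open>The map -w_0(J) is an involution preserving the nonnegative cone on J, whose extreme
  rays are spanned by the simple roots. Concretely, b = -w_0 \<alpha>_s is split as c \<alpha>_t +
  b' with c > 0. Applying -w_0 writes \<alpha>_s as a sum of nonnegative vectors, so -w_0 \<alpha>_t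
  is a multiple of \<alpha>_s, and the invariant form fixes the factor as 1.\<close>

lemma w0_alpha:
  assumes s: "s \<in> J"
  shows "w0 J \<otimes> s \<otimes> w0 J \<in> J" "act (w0 J) (\<alpha> s) = - \<alpha> (w0 J \<otimes> s \<otimes> w0 J)"
proof -
  have sS: "s \<in> S" using s J by auto
  have nonpos: "nonneg (- act (w0 J) (\<alpha> r))" if "r \<in> J" for r
    using nonpos_if_longest[OF _ _ that] w0_longest by simp
  define b where "b = - act (w0 J) (\<alpha> s)"
  have b: "nonneg b" using nonpos s by (simp add: b_def)
  have "b \<noteq> 0" using act_alpha_nonzero[OF w0_carrier, of s] by (simp add: b_def)
  then obtain t where t: "t \<in> Poly_Mapping.keys b" by fastforce
  have "Poly_Mapping.keys (act (w0 J) (\<alpha> s)) \<subseteq> J"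
    by (rule keys_act[OF J w0_parabolic]) (simp add: s)
  then have keys_b: "Poly_Mapping.keys b \<subseteq> J"
    by (auto simp: b_def in_keys_iff)
  then have tJ: "t \<in> J" using t by auto
  then have tS: "t \<in> S" using J by auto
  define c where "c = Poly_Mapping.lookup b t"
  have c: "c > 0" using b t by (auto simp: c_def nonneg_def in_keys_iff order.not_eq_order_implies_strict)
  define b' where "b' = b + smul (- c) (\<alpha> t)"
  have b': "nonneg b'" "Poly_Mapping.keys b' \<subseteq> J"
    using b keys_b by (auto simp: b'_def nonneg_def lookup_add lookup_alpha c_def in_keys_iff split: if_splits)
  have "b = smul c (\<alpha> t) + b'"
    by (rule poly_mapping_eqI) (simp add: b'_def lookup_add)
  then have "- \<alpha> s = smul c (act (w0 J) (\<alpha> t)) + act (w0 J) b'"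
    using arg_cong[OF b_def, of "act (w0 J)"] by (simp add: act_minus act_add act_smul)
  then have sum: "Poly_Mapping.lookup (\<alpha> s) k = c * Poly_Mapping.lookup (- act (w0 J) (\<alpha> t)) k
      + Poly_Mapping.lookup (- act (w0 J) b') k" for k
    by (metis (no_types, opaque_lifting) add.inverse_inverse lookup_add lookup_smul lookup_uminus minus_add_distrib mult_minus_right)
  have nn: "nonneg (- act (w0 J) (\<alpha> t))" "nonneg (- act (w0 J) b')"
    using nonpos tJ nonpos_act[OF w0_carrier nonpos b'] by auto
  define d where "d = Poly_Mapping.lookup (- act (w0 J) (\<alpha> t)) s"
  have neg: "- act (w0 J) (\<alpha> t) = smul d (\<alpha> s)"
  proof (rule poly_mapping_eqI)
    fix k
    have n: "c * Poly_Mapping.lookup (- act (w0 J) (\<alpha> t)) k \<ge> 0" "Poly_Mapping.lookup (- act (w0 J) b') k \<ge> 0"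
      using nn c by (auto simp: nonneg_def simp del: lookup_uminus)
    show "Poly_Mapping.lookup (- act (w0 J) (\<alpha> t)) k = Poly_Mapping.lookup (smul d (\<alpha> s)) k"
    proof (cases "k = s")
      case False
      then have "c * Poly_Mapping.lookup (- act (w0 J) (\<alpha> t)) k = 0"
        using n sum[of k] lookup_alpha[of s k] by (metis add_nonneg_eq_0_iff)
      then show ?thesis using c False by (simp add: lookup_alpha)
    qed (simp add: d_def lookup_alpha)
  qed
  have "d \<ge> 0" using nn(1) by (simp add: d_def nonneg_def)
  have "form (- act (w0 J) (\<alpha> t)) (- act (w0 J) (\<alpha> t)) = 1"
    using tS by (simp add: form_minus_one form_act)
  then have "d * d = 1"
    unfolding neg using sS by (simp add: form_smul_left form_smul_right)
  then have "d = 1" using \<open>d \<ge> 0\<close> by (metis abs_of_nonneg abs_1 abs_mult_self_eq real_sqrt_abs2 real_sqrt_one)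
  then have "- act (w0 J) (\<alpha> t) = \<alpha> s" using neg by (simp add: smul_simps)
  then have "act (w0 J) (\<alpha> t) = - \<alpha> s" by (metis minus_minus)
  then have "act (w0 J) (act (w0 J) (\<alpha> t)) = - act (w0 J) (\<alpha> s)"
    by (simp add: act_minus)
  then have act_s: "act (w0 J) (\<alpha> s) = - \<alpha> t" by simp
  \<comment> \<open>The criterion \<open>conj_S_eq\<close> wants a simple root as image; the extra
    factor s repairs the sign and commutes with s, so the conjugate is unchanged.\<close>
  then have "act (w0 J \<otimes> s) (\<alpha> s) = \<alpha> t"
    using sS by (simp add: act_mult_S_alpha)
  then have "w0 J \<otimes> s \<otimes> s \<otimes> inv (w0 J \<otimes> s) = t"
    using sS tS S_carrier by (intro conj_S_eq) auto
  then have "w0 J \<otimes> s \<otimes> w0 J = t"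
    using sS S_carrier by (simp add: inv_mult_group m_assoc)
  then show "w0 J \<otimes> s \<otimes> w0 J \<in> J" "act (w0 J) (\<alpha> s) = - \<alpha> (w0 J \<otimes> s \<otimes> w0 J)"
    using tJ act_s by auto
qed

end

section \<open>Conjugation of parabolic subgroups\<close>

lemma word_induct_parabolic [consumes 2, case_names one mult]:
  assumes J: "J \<subseteq> S" and w: "w \<in> parabolic J"
    and one: "P \<one>"
    and mult: "\<And>s w. s \<in> J \<Longrightarrow> s \<in> S \<Longrightarrow> s \<in> carrier W \<Longrightarrow> w \<in> carrier W \<Longrightarrow> P w \<Longrightarrow> P (s \<otimes> w)"
  shows "P w"
proof -
  have "P (word_prod W ws)" if "set ws \<subseteq> J" for ws
    using that
  proof (induction ws)
    case (Cons s ws)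
    have "ws \<in> lists S" using Cons J by auto
    then show ?case
      using Cons J S_carrier mult[of s "word_prod W ws"] word_prod_closed_S by auto
  qed (simp add: one)
  moreover obtain ws where "ws \<in> lists J" "w = word_prod W ws"
    using w unfolding parabolic_words[OF J] by blast
  ultimately show ?thesis by (auto simp: in_lists_conv_set)
qed

lemma conj_parabolic:
  assumes "J \<subseteq> S" "w \<in> parabolic J" "K \<subseteq> S" "h \<in> carrier W" "\<And>s. s \<in> J \<Longrightarrow> h \<otimes> s \<otimes> inv h \<in> K"
  shows "h \<otimes> w \<otimes> inv h \<in> parabolic K"
  using assms(1,2)
proof (induction rule: word_induct_parabolic)
  case one
  then show ?case using assms(3,4) subgroup.one_closed[OF parabolic_subgroup] by simp
next
  case (mult s w)
  have "inv h \<otimes> (h \<otimes> v) = v" if "v \<in> carrier W" for v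
    using assms(4) that by (simp flip: m_assoc)
  then have "h \<otimes> (s \<otimes> w) \<otimes> inv h = (h \<otimes> s \<otimes> inv h) \<otimes> (h \<otimes> w \<otimes> inv h)"
    using mult.hyps assms(4) by (simp add: m_assoc)
  then show ?case using mult assms(5) parabolic_mult[OF assms(3)] parabolic_incl by metis
qed

lemma commute_parabolic:
  assumes "J \<subseteq> S" "w \<in> parabolic J" "z \<in> carrier W" "\<And>s. s \<in> J \<Longrightarrow> z \<otimes> s = s \<otimes> z"
  shows "z \<otimes> w = w \<otimes> z"
  using assms(1,2)
proof (induction rule: word_induct_parabolic)
  case (mult s w)
  then show ?case using assms(3,4) by (metis m_assoc)
qed (use assms(3) in simp)

lemma act_fix_parabolic:
  assumes "J \<subseteq> S" "w \<in> parabolic J" "\<And>s. s \<in> J \<Longrightarrow> cos_form s r = 0"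
  shows "act w (\<alpha> r) = \<alpha> r"
  using assms(1,2)
proof (induction rule: word_induct_parabolic)
  case (mult s w)
  then show ?case using assms(3) by (simp add: act_mult act_S refl_orthogonal)
qed simp

lemma conj_inj:
  assumes "h \<in> carrier W" "a \<in> carrier W" "b \<in> carrier W" "h \<otimes> a \<otimes> inv h = h \<otimes> b \<otimes> inv h"
  shows "a = b"
proof -
  have "h \<otimes> a = h \<otimes> b" using assms right_cancel[of "inv h" "h \<otimes> a" "h \<otimes> b"] by blast
  then show ?thesis using assms Units_l_cancel[of h a b] Units_eq by blast
qed

lemma w0_conj_image:
  assumes J: "J \<subseteq> S" and fin: "finite_type J"
  shows "(\<lambda>s. w0 J \<otimes> s \<otimes> w0 J) ` J = J"
proof
  show "(\<lambda>s. w0 J \<otimes> s \<otimes> w0 J) ` J \<subseteq> J" using w0_alpha(1)[OF assms] by auto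
  show "J \<subseteq> (\<lambda>s. w0 J \<otimes> s \<otimes> w0 J) ` J"
  proof
    fix s assume s: "s \<in> J"
    then have [simp]: "s \<in> carrier W" using J S_carrier by auto
    note [simp] = w0_carrier[OF assms] w0_square[OF assms]
    have "s = w0 J \<otimes> (w0 J \<otimes> s \<otimes> w0 J) \<otimes> w0 J"
      by (simp add: m_assoc) (simp flip: m_assoc)
    then show "s \<in> (\<lambda>s. w0 J \<otimes> s \<otimes> w0 J) ` J" using w0_alpha(1)[OF assms s] by blast
  qed
qed

text \<open>Three longest elements each negate a simple root, so the product on the right has the
  signs required by \<open>w0_eqI\<close>. This identity is the reason why reversing an edge inverts
  its element.\<close>

lemma w0_diff_conj:
  assumes K: "K \<subseteq> S" and fin: "finite_type K" and s: "s \<in> K"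
  shows "w0 (K - {w0 K \<otimes> s \<otimes> w0 K}) = w0 K \<otimes> w0 (K - {s}) \<otimes> w0 K"
proof -
  let ?t = "w0 K \<otimes> s \<otimes> w0 K"
  have K': "K - {s} \<subseteq> S" "K - {?t} \<subseteq> S" "finite_type (K - {s})" "finite_type (K - {?t})"
    using K fin finite_type_mono[of "K - {s}" K] finite_type_mono[of "K - {?t}" K] by auto
  note [simp] = w0_carrier[OF K fin] w0_carrier[OF K'(1,3)] w0_inv[OF K fin] w0_square[OF K fin]
  have [simp]: "r \<in> carrier W" if "r \<in> K" for r using that K S_carrier by auto
  have diff: "w0 K \<otimes> r \<otimes> w0 K \<in> K - {?t}" if "r \<in> K - {s}" for r
    using that w0_alpha(1)[OF K fin, of r] conj_inj[of "w0 K" r s] s by auto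
  have diff': "w0 K \<otimes> r \<otimes> w0 K \<in> K - {s}" if "r \<in> K - {?t}" for r
  proof -
    have "r = ?t" if "w0 K \<otimes> r \<otimes> w0 K = s"
    proof -
      have "?t = (w0 K \<otimes> w0 K) \<otimes> r \<otimes> (w0 K \<otimes> w0 K)"
        using \<open>r \<in> K - _\<close> unfolding that[symmetric] by (simp only: m_assoc w0_carrier[OF K fin] m_closed DiffD1 \<open>\<And>r. r \<in> K \<Longrightarrow> r \<in> carrier W\<close>)
      then show ?thesis using \<open>r \<in> K - _\<close> by simp
    qed
    then show ?thesis using that w0_alpha(1)[OF K fin, of r] by blast
  qed
  show ?thesis
  proof (rule w0_eqI[OF K'(2,4)])
    show "w0 K \<otimes> w0 (K - {s}) \<otimes> w0 K \<in> parabolic (K - {?t})"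
      using conj_parabolic[OF K'(1) w0_parabolic[OF K'(1,3)] K'(2), of "w0 K"] diff by simp
  next
    fix r assume r: "r \<in> K - {?t}"
    define r1 r2 where "r1 = w0 K \<otimes> r \<otimes> w0 K" and "r2 = w0 (K - {s}) \<otimes> r1 \<otimes> w0 (K - {s})"
    have r1: "r1 \<in> K - {s}" "act (w0 K) (\<alpha> r) = - \<alpha> r1"
      using diff' w0_alpha(2)[OF K fin] r by (auto simp: r1_def)
    have r2: "r2 \<in> K - {s}" "act (w0 (K - {s})) (\<alpha> r1) = - \<alpha> r2"
      using w0_alpha[OF K'(1,3) r1(1)] by (auto simp: r2_def)
    have "act (w0 K \<otimes> w0 (K - {s}) \<otimes> w0 K) (\<alpha> r) = - \<alpha> (w0 K \<otimes> r2 \<otimes> w0 K)"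
      using w0_alpha(2)[OF K fin, of r2] r2 by (simp add: act_mult act_minus r1 r2)
    then show "nonneg (- act (w0 K \<otimes> w0 (K - {s}) \<otimes> w0 K) (\<alpha> r))"
      by (simp add: nonneg_alpha)
  qed
qed

subsection \<open>Components of the Coxeter graph\<close>

lemma sym_cox_edges: "J \<subseteq> S \<Longrightarrow> sym ((cox_edges J)\<^sup>*)"
  by (intro sym_rtrancl symI) (auto simp: cox_edges_def m_commute subset_iff)

text \<open>Replaces the union of components by reachability from s; symmetry of the edge relation
  makes any component containing s equal to the class of s.\<close>

lemma near_singleton:
  assumes "X \<subseteq> S" "s \<in> S"
  shows "near X {s} = (cox_edges (insert s X))\<^sup>* `` {s}"
proof -
  have sym: "sym ((cox_edges (insert s X))\<^sup>*)" using assms by (intro sym_cox_edges) auto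
  have "C = (cox_edges (insert s X))\<^sup>* `` {s}" if C: "C \<in> components (insert s X)" "s \<in> C" for C
  proof -
    obtain x where x: "C = (cox_edges (insert s X))\<^sup>* `` {x}"
      using C(1) unfolding components_def by (auto elim: quotientE)
    then have xs: "(x, s) \<in> (cox_edges (insert s X))\<^sup>*" using C(2) by auto
    then have "(s, x) \<in> (cox_edges (insert s X))\<^sup>*" using sym by (meson symD)
    with xs show ?thesis unfolding x by (auto intro: rtrancl_trans)
  qed
  moreover have "(cox_edges (insert s X))\<^sup>* `` {s} \<in> components (insert s X)"
    unfolding components_def by (rule quotientI) simp
  moreover have "s \<in> (cox_edges (insert s X))\<^sup>* `` {s}" by simp
  ultimately have "{C \<in> components (X \<union> {s}). C \<inter> {s} \<noteq> {}} = {(cox_edges (insert s X))\<^sup>* `` {s}}"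
    unfolding Un_insert_right Un_empty_right by blast
  then show ?thesis unfolding near_def by simp
qed

lemma rtrancl_cox_edges_subset: "(s, r) \<in> (cox_edges J)\<^sup>* \<Longrightarrow> s \<in> J \<Longrightarrow> r \<in> J"
  by (induction rule: rtrancl_induct) (auto simp: cox_edges_def)

lemma near_subset: "X \<subseteq> S \<Longrightarrow> s \<in> S \<Longrightarrow> near X {s} \<subseteq> insert s X"
  using rtrancl_cox_edges_subset[of s _ "insert s X"] by (auto simp: near_singleton)

lemma mem_near: "X \<subseteq> S \<Longrightarrow> s \<in> S \<Longrightarrow> s \<in> near X {s}"
  by (simp add: near_singleton)

lemma near_orthogonal:
  assumes X: "X \<subseteq> S" "s \<in> S" and k: "k \<in> near X {s}" and r: "r \<in> X" "r \<notin> near X {s}"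
  shows "m k r = 2"
proof -
  have kX: "k \<in> insert s X" using near_subset[OF X] k by auto
  have "k \<noteq> r" using k r by auto
  have "(k, r) \<notin> cox_edges (insert s X)"
    using k r(2) unfolding near_singleton[OF X] by (auto intro: rtrancl_into_rtrancl)
  then have "m k r \<noteq> 0" "m k r < 3"
    using kX r \<open>k \<noteq> r\<close> by (auto simp: cox_edges_def)
  moreover have "m k r \<noteq> 1"
    using m_eq_1_iff[of k r] \<open>k \<noteq> r\<close> kX r X by auto
  ultimately show ?thesis by linarith
qed

text \<open>A component does not depend on which of its members is singled out. This is used to
  exchange s for the label of the reversed edge.\<close>

lemma near_eq_near:
  assumes "X \<subseteq> S" "s \<in> S" "Y \<subseteq> S" "t \<in> near X {s}" "insert t Y = insert s X"
  shows "near Y {t} = near X {s}"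
proof -
  have t: "t \<in> S" using assms near_subset[OF assms(1,2)] by auto
  have st: "(s, t) \<in> (cox_edges (insert s X))\<^sup>*"
    using assms near_singleton by auto
  moreover have "sym ((cox_edges (insert s X))\<^sup>*)"
    using assms by (intro sym_cox_edges) auto
  ultimately have "(t, s) \<in> (cox_edges (insert s X))\<^sup>*" by (meson symD)
  with st show ?thesis
    unfolding near_singleton[OF assms(1,2)] near_singleton[OF assms(3) t] assms(5)
    by (auto intro: rtrancl_trans)
qed

end

context coxeter_groupoid
begin

subsection \<open>Edges of the groupoid\<close>

lemma injections_S: "x \<in> injections \<Longrightarrow> l \<in> \<Lambda> \<Longrightarrow> x l \<in> S"
  by (auto simp: injections_def)

lemma injections_image_S: "x \<in> injections \<Longrightarrow> x ` \<Lambda> \<subseteq> S"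
  by (auto simp: injections_S)

lemma verts_injections: "x \<in> verts_C \<Longrightarrow> x \<in> injections"
  by (simp add: verts_C_def)

lemma hom_C_carrier: "w \<in> hom_C x y \<Longrightarrow> w \<in> carrier W"
  by (simp add: hom_C_def)

lemma hom_C_comp: "w \<in> hom_C x y \<Longrightarrow> v \<in> hom_C y z \<Longrightarrow> w \<otimes> v \<in> hom_C x z"
  by (auto simp: hom_C_def act_mult)

lemma hom_C_inv: "w \<in> hom_C x y \<Longrightarrow> inv w \<in> hom_C y x"
  by (auto simp: hom_C_def)

lemma hom_C_one: "\<one> \<in> hom_C x x"
  by (simp add: hom_C_def)

lemma xI_injections: "x\<^sub>I \<in> injections"
  using xI_maps xI_inj by (simp add: injections_def)

lemma xI_verts: "x\<^sub>I \<in> verts_C"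
  using xI_injections hom_C_one by (auto simp: verts_C_def)

lemma verts_C_closed: "z \<in> verts_C \<Longrightarrow> y \<in> injections \<Longrightarrow> w \<in> hom_C y z \<Longrightarrow> y \<in> verts_C"
  unfolding verts_C_def using hom_C_comp by blast

lemma hom_C_connected:
  assumes "y \<in> verts_C" "z \<in> verts_C"
  obtains w where "w \<in> hom_C y z"
  using assms hom_C_comp hom_C_inv unfolding verts_C_def by blast

lemma hom_C_conj:
  assumes "x \<in> injections" "y \<in> injections" "w \<in> hom_C x y" "l \<in> \<Lambda>"
  shows "w \<otimes> y l \<otimes> inv w = x l"
  using assms by (intro conj_S_eq) (auto simp: hom_C_def injections_S)

lemma vact_eqI:
  assumes "x \<in> injections" "w \<in> hom_C x y"
  shows "vact w y = x"
  unfolding vact_def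
proof (rule the_equality)
  fix z assume z: "z \<in> injections \<and> w \<in> hom_C z y"
  show "z = x"
  proof
    fix l show "z l = x l"
    proof (cases "l \<in> \<Lambda>")
      case True
      then have "\<alpha> (z l) = \<alpha> (x l)" using z assms(2) by (simp add: hom_C_def)
      then show ?thesis by simp
    next
      \<comment> \<open>Off \<open>\<Lambda>\<close> both functions are \<open>undefined\<close> by
        extensionality.\<close>
      case False
      then show ?thesis using z assms(1) by (auto simp: injections_def PiE_def extensional_def)
    qed
  qed
qed (use assms in blast)

context
  fixes x s
  assumes e: "(x, s) \<in> edges_C"
begin

lemma edge_src: "x \<in> verts_C" "x \<in> injections" "x ` \<Lambda> \<subseteq> S"
  using e verts_injections injections_image_S by (auto simp: edges_C_def)

lemma edge_s: "s \<in> S" "s \<notin> x ` \<Lambda>"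
  using e by (auto simp: edges_C_def)

abbreviation (input) K where "K \<equiv> near (x ` \<Lambda>) {s}"

lemma edge_near:
  "K \<subseteq> S" "finite_type K" "s \<in> K" "K \<subseteq> insert s (x ` \<Lambda>)" "K - {s} \<subseteq> S" "finite_type (K - {s})"
proof -
  show "K \<subseteq> insert s (x ` \<Lambda>)" using near_subset edge_src(3) edge_s(1) by blast
  then show "K \<subseteq> S" using edge_src(3) edge_s(1) by blast
  then show "K - {s} \<subseteq> S" by blast
  show "finite_type K" using e by (simp add: edges_C_def)
  then show "finite_type (K - {s})" by (rule finite_type_mono[rotated]) blast
  show "s \<in> K" using mem_near edge_src(3) edge_s(1) by blast
qed

lemma w0_near_carrier [simp]: "w0 K \<in> carrier W" "w0 (K - {s}) \<in> carrier W"
  using w0_carrier edge_near by blast+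

lemma w0_near_inv [simp]: "inv (w0 K) = w0 K" "inv (w0 (K - {s})) = w0 (K - {s})"
  using w0_inv edge_near by blast+

lemma w0_near_square [simp]: "w0 K \<otimes> w0 K = \<one>" "w0 (K - {s}) \<otimes> w0 (K - {s}) = \<one>"
  using w0_square edge_near by blast+

lemma wgen_carrier [simp]: "wgen x s \<in> carrier W"
  by (simp add: wgen_def)

lemma wgen_inv: "inv (wgen x s) = w0 (K - {s}) \<otimes> w0 K"
  by (simp add: wgen_def inv_mult_group)

lemma wgen_parabolic: "wgen x s \<in> parabolic K"
proof -
  have "w0 (K - {s}) \<in> parabolic K"
    using w0_parabolic[OF edge_near(5,6)] parabolic_mono[of "K - {s}" K] by blast
  then show ?thesis
    unfolding wgen_def using parabolic_mult[OF edge_near(1) w0_parabolic[OF edge_near(1,2)]] by blast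
qed

text \<open>Each of the two longest elements contributes one sign, and the signs cancel.\<close>

lemma wgen_conj_near:
  assumes "r \<in> K - {s}"
  shows "wgen x s \<otimes> r \<otimes> inv (wgen x s) \<in> K"
    and "act (wgen x s) (\<alpha> r) = \<alpha> (wgen x s \<otimes> r \<otimes> inv (wgen x s))"
    and "wgen x s \<otimes> r \<otimes> inv (wgen x s) = w0 K \<otimes> (w0 (K - {s}) \<otimes> r \<otimes> w0 (K - {s})) \<otimes> w0 K"
proof -
  define r' where "r' = w0 (K - {s}) \<otimes> r \<otimes> w0 (K - {s})"
  have [simp]: "r \<in> carrier W" using assms edge_near(1) S_carrier by auto
  show conj: "wgen x s \<otimes> r \<otimes> inv (wgen x s) = w0 K \<otimes> (w0 (K - {s}) \<otimes> r \<otimes> w0 (K - {s})) \<otimes> w0 K"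
    unfolding wgen_inv by (simp add: wgen_def m_assoc)
  have r': "r' \<in> K - {s}" "act (w0 (K - {s})) (\<alpha> r) = - \<alpha> r'"
    using w0_alpha[OF edge_near(5,6) assms] by (simp_all add: r'_def)
  have r'': "w0 K \<otimes> r' \<otimes> w0 K \<in> K" "act (w0 K) (\<alpha> r') = - \<alpha> (w0 K \<otimes> r' \<otimes> w0 K)"
    using w0_alpha[OF edge_near(1,2), of r'] r'(1) by simp_all
  show "wgen x s \<otimes> r \<otimes> inv (wgen x s) \<in> K"
    unfolding conj using r''(1) by (simp add: r'_def)
  show "act (wgen x s) (\<alpha> r) = \<alpha> (wgen x s \<otimes> r \<otimes> inv (wgen x s))"
    unfolding conj using r''(2) r'(2) by (simp add: wgen_def act_mult act_minus r'_def)
qed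

text \<open>A letter outside the component of s is orthogonal to that component and commutes with
  it, while the generator lies in the parabolic subgroup of the component.\<close>

lemma wgen_conj_far:
  assumes "r \<in> x ` \<Lambda>" "r \<notin> K"
  shows "wgen x s \<otimes> r \<otimes> inv (wgen x s) = r"
    and "act (wgen x s) (\<alpha> r) = \<alpha> r"
proof -
  have rS: "r \<in> S" using assms edge_src(3) by blast
  note [simp] = S_carrier[OF rS]
  have m2: "m k r = 2" if "k \<in> K" for k
    using near_orthogonal[OF edge_src(3) edge_s(1) that assms] .
  show "act (wgen x s) (\<alpha> r) = \<alpha> r"
    by (rule act_fix_parabolic[OF edge_near(1) wgen_parabolic]) (simp add: cos_form_eq_0 m2)
  have "r \<otimes> k = k \<otimes> r" if "k \<in> K" for k
    using m_eq_2_commute[of k r] m2[OF that] that edge_near(1) rS by auto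
  then have "r \<otimes> wgen x s = wgen x s \<otimes> r"
    by (intro commute_parabolic[OF edge_near(1) wgen_parabolic]) auto
  then have "wgen x s \<otimes> r \<otimes> inv (wgen x s) = r \<otimes> (wgen x s \<otimes> inv (wgen x s))"
    by (simp only: m_assoc[symmetric] wgen_carrier inv_closed \<open>r \<in> carrier W\<close>)
  then show "wgen x s \<otimes> r \<otimes> inv (wgen x s) = r" by simp
qed

lemma wgen_conj:
  assumes "l \<in> \<Lambda>"
  shows "wgen x s \<otimes> x l \<otimes> inv (wgen x s) \<in> S"
    and "act (wgen x s) (\<alpha> (x l)) = \<alpha> (wgen x s \<otimes> x l \<otimes> inv (wgen x s))"
proof -
  have xl: "x l \<in> x ` \<Lambda>" "x l \<noteq> s" "x l \<in> S" using assms edge_s edge_src(3) by auto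
  show "wgen x s \<otimes> x l \<otimes> inv (wgen x s) \<in> S"
    using wgen_conj_near(1)[of "x l"] wgen_conj_far(1)[of "x l"] xl edge_near(1) by (cases "x l \<in> K") auto
  show "act (wgen x s) (\<alpha> (x l)) = \<alpha> (wgen x s \<otimes> x l \<otimes> inv (wgen x s))"
    using wgen_conj_near(2)[of "x l"] wgen_conj_far[of "x l"] xl by (cases "x l \<in> K") auto
qed

text \<open>The target is a definite description, so a candidate is first built by conjugating the
  values of x and then identified by \<open>vact_eqI\<close>.\<close>

lemma tgt_injections: "tgt (x, s) \<in> injections"
  and wgen_hom_C: "wgen x s \<in> hom_C (tgt (x, s)) x"
proof -
  define y where "y = (\<lambda>l\<in>\<Lambda>. wgen x s \<otimes> x l \<otimes> inv (wgen x s))"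
  have xl: "x l \<in> carrier W" if "l \<in> \<Lambda>" for l
    using that edge_src S_carrier by blast
  have "inj_on y \<Lambda>"
  proof (rule inj_onI)
    fix l l' assume l: "l \<in> \<Lambda>" "l' \<in> \<Lambda>" "y l = y l'"
    then have "x l = x l'"
      using conj_inj[of "wgen x s" "x l" "x l'"] xl by (simp add: y_def)
    then show "l = l'" using edge_src(2) l by (auto simp: injections_def inj_on_def)
  qed
  then have y: "y \<in> injections"
    using wgen_conj(1) by (auto simp: injections_def y_def)
  moreover have hom: "wgen x s \<in> hom_C y x"
    using wgen_conj(2) by (simp add: hom_C_def y_def)
  ultimately have "tgt (x, s) = y"
    unfolding tgt_def using vact_eqI by simp
  then show "tgt (x, s) \<in> injections" "wgen x s \<in> hom_C (tgt (x, s)) x"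
    using y hom by auto
qed

lemma tgt_verts: "tgt (x, s) \<in> verts_C"
  using verts_C_closed[OF edge_src(1) tgt_injections wgen_hom_C] .

lemma tgt_apply: "l \<in> \<Lambda> \<Longrightarrow> tgt (x, s) l = wgen x s \<otimes> x l \<otimes> inv (wgen x s)"
  using hom_C_conj[OF tgt_injections edge_src(2) wgen_hom_C] by simp

text \<open>The label of the reversed edge: the one letter of the component that the target
  misses.\<close>

definition opp where "opp = w0 K \<otimes> s \<otimes> w0 K"

lemma opp_near: "opp \<in> K"
  unfolding opp_def using w0_alpha(1)[OF edge_near(1,2,3)] .

text \<open>The inner longest element permutes K - {s}; the outer one permutes K and moves s to
  \<open>opp\<close>. Letters outside K stay fixed.\<close>

lemma tgt_image: "tgt (x, s) ` \<Lambda> = (x ` \<Lambda> - K) \<union> (K - {opp})"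
proof -
  let ?c = "\<lambda>r. wgen x s \<otimes> r \<otimes> inv (wgen x s)"
  have split: "x ` \<Lambda> = (x ` \<Lambda> - K) \<union> (K - {s})"
    using edge_near(4) edge_s(2) by blast
  have inj: "inj_on (\<lambda>r. w0 K \<otimes> r \<otimes> w0 K) K"
  proof (rule inj_onI)
    fix a b assume "a \<in> K" "b \<in> K" "w0 K \<otimes> a \<otimes> w0 K = w0 K \<otimes> b \<otimes> w0 K"
    then show "a = b"
      using conj_inj[of "w0 K" a b] edge_near(1) S_carrier by auto
  qed
  have "?c ` (K - {s}) = (\<lambda>r. w0 K \<otimes> r \<otimes> w0 K) ` ((\<lambda>r. w0 (K - {s}) \<otimes> r \<otimes> w0 (K - {s})) ` (K - {s}))"
    unfolding image_image using wgen_conj_near(3) by (intro image_cong) auto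
  also have "\<dots> = (\<lambda>r. w0 K \<otimes> r \<otimes> w0 K) ` (K - {s})"
    unfolding w0_conj_image[OF edge_near(5,6)] ..
  also have "\<dots> = K - {opp}"
    using inj_on_image_set_diff[OF inj, of K "{s}"] edge_near(3) w0_conj_image[OF edge_near(1,2)]
    by (simp add: opp_def)
  finally have near: "?c ` (K - {s}) = K - {opp}" .
  have "?c ` (x ` \<Lambda> - K) = x ` \<Lambda> - K"
    using wgen_conj_far(1) by (auto simp: image_iff)
  moreover have "tgt (x, s) ` \<Lambda> = ?c ` (x ` \<Lambda>)"
    unfolding image_image using tgt_apply by (intro image_cong) auto
  ultimately show ?thesis
    by (subst (asm) (3) split) (simp add: image_Un near)
qed

lemma opp_not_tgt: "opp \<notin> tgt (x, s) ` \<Lambda>"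
  unfolding tgt_image using opp_near by blast

lemma insert_opp: "insert opp (tgt (x, s) ` \<Lambda>) = insert s (x ` \<Lambda>)"
  unfolding tgt_image using opp_near edge_near(3,4) by blast

lemma inv_edge_eq: "inv_edge (x, s) = (tgt (x, s), opp)"
proof -
  have "insert s (x ` \<Lambda>) - tgt (x, s) ` \<Lambda> = {opp}"
    unfolding insert_opp[symmetric] using opp_not_tgt by (simp add: insert_Diff_if)
  then have "(THE t. {t} = (x ` \<Lambda> \<union> {s}) - tgt (x, s) ` \<Lambda>) = opp"
    by (intro the_equality) auto
  then show ?thesis by (simp add: inv_edge_def src_def)
qed

lemma near_opp: "near (tgt (x, s) ` \<Lambda>) {opp} = K"
  using near_eq_near[OF edge_src(3) edge_s(1) injections_image_S[OF tgt_injections] opp_near insert_opp] .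

lemma inv_edge_edges_C: "inv_edge (x, s) \<in> edges_C"
  unfolding inv_edge_eq edges_C_def
  using tgt_verts opp_near edge_near(1,2) opp_not_tgt near_opp by auto

lemma wgen_opp: "wgen (tgt (x, s)) opp = inv (wgen x s)"
proof -
  have "wgen (tgt (x, s)) opp = w0 K \<otimes> (w0 K \<otimes> w0 (K - {s}) \<otimes> w0 K)"
    unfolding wgen_def near_opp using w0_diff_conj[OF edge_near(1,2,3)] by (simp add: opp_def)
  also have "\<dots> = (w0 K \<otimes> w0 K) \<otimes> w0 (K - {s}) \<otimes> w0 K"
    by (simp only: m_assoc m_closed w0_near_carrier)
  finally show ?thesis unfolding wgen_inv by simp
qed

end

lemma edges_C_cases:
  assumes "e \<in> edges_C"
  obtains x s where "e = (x, s)" "(x, s) \<in> edges_C"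
  using assms by (cases e) auto

definition elem :: "('l \<Rightarrow> 'a) \<times> 'a \<Rightarrow> 'a" where
  "elem e = wgen (fst e) (snd e)"

lemma
  assumes "e \<in> edges_C"
  shows inv_edge_in: "inv_edge e \<in> edges_C"
    and elem_carrier: "elem e \<in> carrier W"
    and tgt_edge_verts: "tgt e \<in> verts_C"
    and src_inv_edge: "src (inv_edge e) = tgt e"
    and tgt_inv_edge: "tgt (inv_edge e) = src e"
    and elem_inv_edge: "elem (inv_edge e) = inv (elem e)"
    and inv_inv_edge: "inv_edge (inv_edge e) = e"
proof -
  obtain x s where e: "e = (x, s)" "(x, s) \<in> edges_C" using assms by (rule edges_C_cases)
  note E = e(2)
  define t where "t = opp x s"
  have inv: "inv_edge (x, s) = (tgt (x, s), t)" unfolding inv_edge_eq[OF E] t_def ..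
  show inC: "inv_edge e \<in> edges_C" unfolding e(1) by (rule inv_edge_edges_C[OF E])
  show "elem e \<in> carrier W" using wgen_carrier[OF E] by (simp add: elem_def e)
  show "tgt e \<in> verts_C" using tgt_verts[OF E] by (simp add: e)
  show "src (inv_edge e) = tgt e" by (simp add: e inv src_def)
  show elem: "elem (inv_edge e) = inv (elem e)"
    unfolding e(1) inv using wgen_opp[OF E] by (simp add: elem_def t_def)
  have "inv (wgen x s) \<in> hom_C x (tgt e)"
    using hom_C_inv[OF wgen_hom_C[OF E]] by (simp add: e)
  then show tgt: "tgt (inv_edge e) = src e"
    using elem vact_eqI[OF edge_src(2)[OF E]] unfolding tgt_def[of "inv_edge e"] e(1) inv
    by (simp add: tgt_def[of "(tgt (x, s), t)"] elem_def src_def e)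
  have yt: "(tgt e, t) \<in> edges_C" using inC inv e by simp
  have "insert (opp (tgt e) t) (x ` \<Lambda>) = insert t (tgt e ` \<Lambda>)"
    using insert_opp[OF yt] tgt by (simp add: inv src_def e)
  also have "\<dots> = insert s (x ` \<Lambda>)"
    using insert_opp[OF E] by (simp add: t_def e)
  finally have "opp (tgt e) t = s"
    using opp_not_tgt[OF yt] tgt edge_s(2)[OF E] by (auto simp: inv src_def e)
  then show "inv_edge (inv_edge e) = e"
    using inv_edge_eq[OF yt] tgt by (simp add: inv src_def e)
qed

subsection \<open>Twists\<close>

context
  fixes y A
  assumes y: "y \<in> verts_C" and A: "A \<in> A_tilde"
begin

lemma A_subset: "A \<subseteq> \<Lambda>"
  using A by (auto simp: A_tilde_def components_\<Lambda>_def)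

lemma y_image_subset: "y ` A \<subseteq> S" "y ` \<Lambda> \<subseteq> S"
  using A_subset y verts_injections injections_image_S by blast+

lemma y_carrier [simp]: "l \<in> \<Lambda> \<Longrightarrow> y l \<in> carrier W"
  using y_image_subset(2) S_carrier by blast

text \<open>Finiteness is assumed at \<open>x\<^sub>I\<close> only; conjugation by a morphism of the
  groupoid transports it to y.\<close>

lemma finite_type_image: "finite_type (y ` A)"
proof -
  obtain w where w: "w \<in> hom_C y x\<^sub>I" using hom_C_connected[OF y xI_verts] .
  then have wc [simp]: "w \<in> carrier W" by (rule hom_C_carrier)
  have xA: "x\<^sub>I ` A \<subseteq> S" using A_subset xI_injections injections_image_S by blast
  have conj: "inv w \<otimes> y l \<otimes> inv (inv w) = x\<^sub>I l" if "l \<in> \<Lambda>" for l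
    by (rule hom_C_conj[OF xI_injections verts_injections[OF y] hom_C_inv[OF w] that])
  have "u \<in> (\<lambda>v. w \<otimes> v \<otimes> inv w) ` parabolic (x\<^sub>I ` A)" if u: "u \<in> parabolic (y ` A)" for u
  proof -
    have uc [simp]: "u \<in> carrier W" using parabolic_carrier[OF y_image_subset(1) u] .
    have "inv w \<otimes> u \<otimes> inv (inv w) \<in> parabolic (x\<^sub>I ` A)"
      using conj A_subset by (intro conj_parabolic[OF y_image_subset(1) u xA]) auto
    moreover have "w \<otimes> (inv w \<otimes> u \<otimes> inv (inv w)) \<otimes> inv w = (w \<otimes> inv w) \<otimes> u \<otimes> (w \<otimes> inv w)"
      by (simp only: m_assoc m_closed inv_closed wc uc inv_inv)
    ultimately show ?thesis by (intro image_eqI) simp_all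
  qed
  then have "parabolic (y ` A) \<subseteq> (\<lambda>v. w \<otimes> v \<otimes> inv w) ` parabolic (x\<^sub>I ` A)" by blast
  moreover have "finite (parabolic (x\<^sub>I ` A))"
    using A by (simp add: A_tilde_def finite_type_def)
  ultimately show ?thesis unfolding finite_type_def using finite_surj by blast
qed

text \<open>A is a union of components, so no edge of the Coxeter graph leaves it.\<close>

lemma m_xI_outside:
  assumes "l \<in> \<Lambda>" "l \<notin> A" "l' \<in> A"
  shows "m (x\<^sub>I l') (x\<^sub>I l) = 2"
proof -
  obtain B where B: "B \<subseteq> \<Lambda>" "x\<^sub>I ` B \<in> components I" "l' \<in> B" "B \<subseteq> A"
    using A assms(3) by (auto simp: A_tilde_def components_\<Lambda>_def)
  obtain i where i: "x\<^sub>I ` B = (cox_edges I)\<^sup>* `` {i}"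
    using B(2) unfolding components_def by (rule quotientE)
  have inj: "x\<^sub>I l \<notin> x\<^sub>I ` B"
    using assms(1,2) B(1,4) xI_inj by (meson inj_on_image_mem_iff subsetD)
  have "(x\<^sub>I l', x\<^sub>I l) \<notin> cox_edges I"
  proof
    assume "(x\<^sub>I l', x\<^sub>I l) \<in> cox_edges I"
    moreover have "(i, x\<^sub>I l') \<in> (cox_edges I)\<^sup>*" using i B(3) by blast
    ultimately have "x\<^sub>I l \<in> x\<^sub>I ` B" unfolding i by auto
    then show False using inj by blast
  qed
  moreover have "x\<^sub>I l \<noteq> x\<^sub>I l'" using inj B(3) by blast
  moreover have "x\<^sub>I l \<in> I" "x\<^sub>I l' \<in> I" using assms A_subset xI_image by auto
  moreover have "m (x\<^sub>I l') (x\<^sub>I l) \<noteq> 1"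
    using m_eq_1_iff[of "x\<^sub>I l'" "x\<^sub>I l"] calculation I_subset by auto
  ultimately show ?thesis unfolding cox_edges_def by (auto simp: eval_nat_numeral not_le)
qed

text \<open>Both facts are transported from \<open>x\<^sub>I\<close>: orthogonality by invariance of
  the form, commutation by conjugation.\<close>

lemma outside_orthogonal:
  assumes l: "l \<in> \<Lambda>" "l \<notin> A" and l': "l' \<in> A"
  shows "cos_form (y l') (y l) = 0" "y l \<otimes> y l' = y l' \<otimes> y l"
proof -
  obtain w where w: "w \<in> hom_C y x\<^sub>I" using hom_C_connected[OF y xI_verts] .
  then have wc [simp]: "w \<in> carrier W" by (rule hom_C_carrier)
  have l'\<Lambda>: "l' \<in> \<Lambda>" using l' A_subset by blast
  have xS: "x\<^sub>I l \<in> S" "x\<^sub>I l' \<in> S" using l l'\<Lambda> xI_injections injections_S by auto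
  note [simp] = S_carrier[OF xS(1)] S_carrier[OF xS(2)]
  have "form (\<alpha> (y l')) (\<alpha> (y l)) = form (act w (\<alpha> (x\<^sub>I l'))) (act w (\<alpha> (x\<^sub>I l)))"
    using w l l'\<Lambda> by (simp add: hom_C_def)
  also have "\<dots> = 0"
    using xS m_xI_outside[OF l l'] by (simp add: form_act cos_form_eq_0)
  finally show "cos_form (y l') (y l) = 0" by simp
  have comm: "x\<^sub>I l \<otimes> x\<^sub>I l' = x\<^sub>I l' \<otimes> x\<^sub>I l"
    using m_eq_2_commute[of "x\<^sub>I l'" "x\<^sub>I l"] m_xI_outside[OF l l'] xS by simp
  have conj: "w \<otimes> x\<^sub>I k \<otimes> inv w = y k" if "k \<in> \<Lambda>" for k
    by (rule hom_C_conj[OF verts_injections[OF y] xI_injections w that])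
  have mult: "(w \<otimes> a \<otimes> inv w) \<otimes> (w \<otimes> b \<otimes> inv w) = w \<otimes> (a \<otimes> b) \<otimes> inv w"
    if "a \<in> carrier W" "b \<in> carrier W" for a b
  proof -
    have "(w \<otimes> a \<otimes> inv w) \<otimes> (w \<otimes> b \<otimes> inv w) = w \<otimes> a \<otimes> (inv w \<otimes> w) \<otimes> b \<otimes> inv w"
      using that by (simp only: m_assoc m_closed inv_closed wc)
    then show ?thesis using that by (simp add: m_assoc)
  qed
  show "y l \<otimes> y l' = y l' \<otimes> y l"
    unfolding conj[OF l(1), symmetric] conj[OF l'\<Lambda>, symmetric] by (simp add: mult comm)
qed

lemma w0_image_carrier [simp]: "w0 (y ` A) \<in> carrier W"
  by (rule w0_carrier[OF y_image_subset(1) finite_type_image])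

lemma w0_image_square [simp]: "w0 (y ` A) \<otimes> w0 (y ` A) = \<one>"
  by (rule w0_square[OF y_image_subset(1) finite_type_image])

lemma w0_image_inv [simp]: "inv (w0 (y ` A)) = w0 (y ` A)"
  by (rule w0_inv[OF y_image_subset(1) finite_type_image])

lemma twist_inside:
  assumes "l \<in> A"
  shows "twist y A l \<in> y ` A" "act (w0 (y ` A)) (\<alpha> (y l)) = - \<alpha> (twist y A l)"
  using w0_alpha[OF y_image_subset(1) finite_type_image, of "y l"] assms A_subset
  by (auto simp: twist_def)

lemma twist_outside:
  assumes l: "l \<in> \<Lambda>" "l \<notin> A"
  shows "twist y A l = y l" "act (w0 (y ` A)) (\<alpha> (y l)) = \<alpha> (y l)"
proof -
  have "y l \<otimes> w0 (y ` A) = w0 (y ` A) \<otimes> y l"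
    using outside_orthogonal(2)[OF l] l
    by (intro commute_parabolic[OF y_image_subset(1) w0_parabolic[OF y_image_subset(1) finite_type_image]]) auto
  then have "w0 (y ` A) \<otimes> y l \<otimes> w0 (y ` A) = y l \<otimes> (w0 (y ` A) \<otimes> w0 (y ` A))"
    using l by (metis m_assoc w0_image_carrier y_carrier)
  then show "twist y A l = y l" using l by (simp add: twist_def)
  show "act (w0 (y ` A)) (\<alpha> (y l)) = \<alpha> (y l)"
    using outside_orthogonal(1)[OF l]
    by (intro act_fix_parabolic[OF y_image_subset(1) w0_parabolic[OF y_image_subset(1) finite_type_image]]) auto
qed

text \<open>A twist only relabels the same set of letters, so everything depending on that set
  alone, such as \<open>near\<close>, is unchanged.\<close>

lemma twist_image: "twist y A ` \<Lambda> = y ` \<Lambda>"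
proof -
  have "twist y A ` A = (\<lambda>r. w0 (y ` A) \<otimes> r \<otimes> w0 (y ` A)) ` (y ` A)"
    unfolding image_image using A_subset by (intro image_cong) (auto simp: twist_def)
  also have "\<dots> = y ` A" by (rule w0_conj_image[OF y_image_subset(1) finite_type_image])
  finally have "twist y A ` A = y ` A" .
  moreover have "twist y A ` (\<Lambda> - A) = y ` (\<Lambda> - A)"
    using twist_outside(1) by (intro image_cong) auto
  moreover have "\<Lambda> = A \<union> (\<Lambda> - A)" using A_subset by blast
  ultimately show ?thesis by (metis image_Un)
qed

lemma twist_injections: "twist y A \<in> injections"
proof -
  have "inj_on (twist y A) \<Lambda>"
  proof (rule inj_onI)
    fix l l' assume l: "l \<in> \<Lambda>" "l' \<in> \<Lambda>" "twist y A l = twist y A l'"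
    then have "y l = y l'"
      using conj_inj[of "w0 (y ` A)" "y l" "y l'"] by (simp add: twist_def)
    then show "l = l'" using verts_injections[OF y] l by (auto simp: injections_def inj_on_def)
  qed
  moreover have "twist y A l \<in> S" if "l \<in> \<Lambda>" for l
    using that twist_image y_image_subset(2) by blast
  ultimately show ?thesis by (auto simp: injections_def twist_def)
qed

lemma act_w0_twist:
  "l \<in> \<Lambda> \<Longrightarrow> act (w0 (y ` A)) (\<alpha> (twist y A l)) = (if l \<in> A then - \<alpha> (y l) else \<alpha> (y l))"
  using twist_inside(2)[of l] twist_outside[of l]
    act_w0_act_w0[OF y_image_subset(1) finite_type_image, of "\<alpha> (y l)"]
  by (cases "l \<in> A") (simp_all add: act_minus, metis minus_minus)

end

text \<open>For labels in A both outer factors change the sign, and for the others neither does, so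
  simple roots again go to simple roots.\<close>

lemma \<tau>_hom_C:
  assumes z: "z \<in> verts_C" and y: "y \<in> verts_C" and A: "A \<in> A_tilde" and w: "w \<in> hom_C z y"
  shows "\<tau> A z y w \<in> hom_C (twist z A) (twist y A)"
proof -
  note [simp] = w0_image_carrier[OF z A] w0_image_carrier[OF y A] hom_C_carrier[OF w]
  have "act (\<tau> A z y w) (\<alpha> (twist y A l)) = \<alpha> (twist z A l)" if l: "l \<in> \<Lambda>" for l
  proof -
    have wl: "act w (\<alpha> (y l)) = \<alpha> (z l)" using w l by (simp add: hom_C_def)
    have "act (w0 (z ` A)) (\<alpha> (z l)) = (if l \<in> A then - \<alpha> (twist z A l) else \<alpha> (twist z A l))"
      using twist_inside(2)[OF z A] twist_outside[OF z A l] by auto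
    then show ?thesis
      using act_w0_twist[OF y A l] by (auto simp: \<tau>_def act_mult act_minus wl)
  qed
  then show ?thesis by (simp add: hom_C_def \<tau>_def)
qed

lemma twist_verts:
  assumes "y \<in> verts_C" "A \<in> A_tilde"
  shows "twist y A \<in> verts_C"
proof -
  obtain w where "w \<in> hom_C y x\<^sub>I" using hom_C_connected[OF assms(1) xI_verts] .
  then have "\<tau> A y x\<^sub>I w \<in> hom_C (twist y A) (twist x\<^sub>I A)"
    by (intro \<tau>_hom_C assms xI_verts)
  moreover have "twist x\<^sub>I A \<in> verts_C" using assms(2) by (simp add: A_tilde_def)
  ultimately show ?thesis using verts_C_closed twist_injections[OF assms] by blast
qed

lemma loop_generator_commute:
  assumes "loop_generator y s" "A \<in> A_tilde"
  shows "wgen y s \<otimes> w0 (y ` A) = w0 (y ` A) \<otimes> wgen y s"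
proof -
  have e: "(y, s) \<in> edges_C" "tgt (y, s) = y"
    using assms(1) by (auto simp: loop_generator_def tgt_def)
  note y = edge_src[OF e(1)]
  note [simp] = wgen_carrier[OF e(1)]
  have "wgen y s \<otimes> y l = y l \<otimes> wgen y s" if "l \<in> \<Lambda>" for l
    using tgt_apply[OF e(1) that] e(2) y_carrier[OF y(1) assms(2) that]
    by (metis inv_solve_right m_closed wgen_carrier[OF e(1)])
  then show ?thesis
    using A_subset[OF y(1) assms(2)]
    by (intro commute_parabolic[OF y_image_subset(1)[OF y(1) assms(2)]
          w0_parabolic[OF y_image_subset(1)[OF y(1) assms(2)] finite_type_image[OF y(1) assms(2)]]]) auto
qed

lemma wgen_twist:
  assumes "y \<in> verts_C" "A \<in> A_tilde"
  shows "wgen (twist y A) s = wgen y s"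
  unfolding wgen_def twist_image[OF assms] ..

subsection \<open>Paths and the maximal tree\<close>

lemma path_verts:
  assumes "E \<subseteq> edges_C" "path E z es y"
  shows "z \<in> verts_C" "y \<in> verts_C"
  using assms(2) by (induction es arbitrary: z) (use assms(1) tgt_edge_verts in auto)

lemma path_append:
  assumes "E \<subseteq> edges_C"
  shows "path E z (es @ fs) y \<longleftrightarrow> (\<exists>x. path E z es x \<and> path E x fs y)"
  by (induction es arbitrary: z) (use path_verts[OF assms] in auto)

lemma path_subset: "path E z es y \<Longrightarrow> set es \<subseteq> E"
  by (induction es arbitrary: z) auto

lemma path_elem_Nil [simp]: "path_elem [] = \<one>"
  by (simp add: path_elem_def)

lemma path_elem_Cons [simp]: "path_elem (e # es) = elem e \<otimes> path_elem es"
  by (simp add: path_elem_def elem_def)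

lemma elem_hom_C: "e \<in> edges_C \<Longrightarrow> elem e \<in> hom_C (tgt e) (src e)"
  using wgen_hom_C by (cases e) (simp add: elem_def src_def)

lemma path_elem_hom_C:
  assumes "E \<subseteq> edges_C" "path E z es y"
  shows "path_elem es \<in> hom_C z y"
  using assms(2)
proof (induction es arbitrary: z)
  case Nil
  then show ?case by (simp add: hom_C_one)
next
  case (Cons e es)
  then have "elem e \<in> hom_C z (src e)" using elem_hom_C[of e] assms(1) by auto
  then show ?case using Cons hom_C_comp by auto
qed

lemma path_elem_closed: "set es \<subseteq> edges_C \<Longrightarrow> path_elem es \<in> carrier W"
  by (induction es) (auto simp: elem_carrier)

lemma path_elem_append:
  "set es \<subseteq> edges_C \<Longrightarrow> set fs \<subseteq> edges_C \<Longrightarrow> path_elem (es @ fs) = path_elem es \<otimes> path_elem fs"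
  by (induction es) (auto simp: elem_carrier path_elem_closed m_assoc)

lemma path_elem_reverse:
  "set es \<subseteq> edges_C \<Longrightarrow> path_elem (map inv_edge (rev es)) = inv (path_elem es)"
proof (induction es)
  case (Cons e es)
  have "set (map inv_edge (rev es)) \<subseteq> edges_C" using Cons inv_edge_in by auto
  then show ?case
    using Cons by (simp add: path_elem_append inv_edge_in elem_inv_edge elem_carrier path_elem_closed inv_mult_group)
qed simp

lemma path_reverse:
  assumes E: "E \<subseteq> edges_C" "inv_edge ` E \<subseteq> E" and "path E z es y"
  shows "path E y (map inv_edge (rev es)) z"
  using assms(3)
proof (induction es arbitrary: z)
  case (Cons e es)
  then have e: "e \<in> E" "tgt e = z" "path E (src e) es y" by auto
  then have "e \<in> edges_C" "inv_edge e \<in> E" using E by auto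
  then have "path E (src e) [inv_edge e] z"
    using e(2) tgt_edge_verts[of e] by (simp add: src_inv_edge tgt_inv_edge)
  then show ?case using Cons.IH[OF e(3)] by (auto simp: path_append[OF E(1)])
qed auto

lemma non_backtracking_iff:
  "non_backtracking es \<longleftrightarrow> successively (\<lambda>e f. e \<noteq> inv_edge f) es"
  unfolding non_backtracking_def successively_conv_nth by auto

lemma non_backtracking_reverse:
  assumes "set es \<subseteq> edges_C" "non_backtracking es"
  shows "non_backtracking (map inv_edge (rev es))"
  using assms(2) unfolding non_backtracking_iff successively_map successively_rev
  by (rule successively_mono) (use assms(1) inv_inv_edge in auto)

end

section \<open>Reduced paths in the tree\<close>

context coxeter_groupoid_tree
begin

lemma T_subset: "T \<subseteq> edges_C"
  using T_maximal_tree by (auto simp: maximal_tree_def edges_Y1_def)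

lemma T_inv: "inv_edge ` T \<subseteq> T"
  using T_maximal_tree by (auto simp: maximal_tree_def)

text \<open>Without circuits, a nonempty closed path must leave some vertex v twice. The stretch
  between two such departures is a strictly shorter nonempty closed path, still without
  backtracking.\<close>

lemma closed_non_backtracking:
  "path T y es y \<Longrightarrow> non_backtracking es \<Longrightarrow> es = []"
proof (induction "length es" arbitrary: es y rule: less_induct)
  case less
  show ?case
  proof (rule ccontr)
    assume ne: "es \<noteq> []"
    have "\<not> circuit T es" using T_maximal_tree by (auto simp: maximal_tree_def)
    then have "\<not> distinct (map src es)" using ne less.prems by (auto simp: circuit_def)
    then obtain xs v ys zs where "map src es = xs @ [v] @ ys @ [v] @ zs"
      using not_distinct_decomp by blast
    then obtain us r1 where 1: "es = us @ r1" "map src r1 = v # ys @ v # zs"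
      by (auto simp: map_eq_append_conv)
    then obtain e r2 where 2: "r1 = e # r2" "src e = v" "map src r2 = ys @ v # zs"
      by (auto simp: map_eq_Cons_conv)
    then obtain vs r3 where 3: "r2 = vs @ r3" "map src r3 = v # zs"
      by (auto simp: map_eq_append_conv)
    then obtain f ws where 4: "r3 = f # ws" "src f = v"
      by (auto simp: map_eq_Cons_conv)
    note v = 2(2) 4(2)
    have es: "es = us @ e # vs @ f # ws" using 1 2 3 4 by simp
    have "path T y ((us @ [e]) @ (vs @ [f]) @ ws) y" using less.prems(1) by (simp add: es)
    then obtain a b where ab: "path T y (us @ [e]) a" "path T a (vs @ [f]) b"
      unfolding path_append[OF T_subset] by blast
    then have "a = src e" "b = src f" by (auto simp: path_append[OF T_subset])
    \<comment> \<open>Lists are read from right to left: f is the earlier departure from v and e the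
      later one, so the stretch contains f but not e.\<close>
    then have "path T v (vs @ [f]) v" using ab(2) v by simp
    moreover have "non_backtracking (vs @ [f])"
      using less.prems(2) unfolding non_backtracking_iff es
      by (auto simp: successively_append_iff successively_Cons)
    moreover have "length (vs @ [f]) < length es" by (simp add: es)
    ultimately show False using less.hyps by blast
  qed
qed

text \<open>If the final edges differ, following one path and returning along the other does not
  backtrack at the junction, which gives a nonempty reduced closed path. If they agree, they are
  removed and the induction continues.\<close>

lemma non_backtracking_path_unique:
  "path T z es y \<Longrightarrow> path T z fs y \<Longrightarrow> non_backtracking es \<Longrightarrow> non_backtracking fs \<Longrightarrow> es = fs"
proof (induction es arbitrary: z fs)
  case Nil
  then show ?case using closed_non_backtracking by fastforce
next
  case (Cons e es)
  show ?case
  proof (cases fs)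
    case Nil
    then show ?thesis using Cons.prems closed_non_backtracking[of y "e # es"] by auto
  next
    case (Cons f fs')
    have T: "set (e # es) \<subseteq> T" "set fs \<subseteq> T" using Cons.prems path_subset by blast+
    have "e = f"
    proof (rule ccontr)
      assume "e \<noteq> f"
      then have ne: "inv_edge f \<noteq> inv_edge e"
        using T T_subset inv_inv_edge unfolding Cons by (metis list.set_intros(1) subsetD)
      have "path T y (map inv_edge (rev fs) @ (e # es)) y"
        using path_reverse[OF T_subset T_inv Cons.prems(2)] Cons.prems(1)
        unfolding path_append[OF T_subset] by blast
      moreover have "non_backtracking (map inv_edge (rev fs) @ (e # es))"
        using non_backtracking_reverse[of fs] Cons.prems(3,4) T(2) T_subset ne
        unfolding non_backtracking_iff successively_append_iff Cons by auto
      ultimately show False using closed_non_backtracking by blast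
    qed
    moreover have "es = fs'"
      using Cons.prems Cons.IH[of "src e" fs'] \<open>e = f\<close> unfolding Cons non_backtracking_iff
      by (auto simp: successively_Cons)
    ultimately show ?thesis using Cons by simp
  qed
qed

text \<open>A path of minimal length works, since an edge next to its inverse could be cut
  out.\<close>

lemma non_backtracking_path_exists:
  assumes "y \<in> verts_C" "z \<in> verts_C"
  shows "\<exists>es. path T z es y \<and> non_backtracking es"
proof -
  have "\<exists>es. path T z es y" using assms T_maximal_tree by (auto simp: maximal_tree_def)
  then obtain es where es: "path T z es y" "\<And>fs. path T z fs y \<Longrightarrow> length es \<le> length fs"
    using ex_has_least_nat[of "\<lambda>es. path T z es y" _ length] by blast
  have "non_backtracking es"
    unfolding non_backtracking_def
  proof (intro allI impI notI)
    fix i assume i: "Suc i < length es" and eq_inv: "es ! i = inv_edge (es ! Suc i)"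
    define us vs f where "us = take i es" and "vs = drop (Suc (Suc i)) es" and "f = es ! Suc i"
    have eq: "es = us @ inv_edge f # f # vs"
      using i eq_inv unfolding us_def vs_def f_def by (metis Cons_nth_drop_Suc Suc_lessD append_take_drop_id)
    then have "f \<in> T" using path_subset[OF es(1)] by auto
    then have f: "f \<in> edges_C" using T_subset by blast
    have "path T z (us @ vs) y"
      using es(1) unfolding eq by (auto simp: path_append[OF T_subset] tgt_inv_edge[OF f])
    then show False using es(2) eq by fastforce
  qed
  with es(1) show ?thesis by blast
qed

lemma tree_path:
  assumes "y \<in> verts_C" "z \<in> verts_C"
  shows "path T z (tree_path z y) y" "non_backtracking (tree_path z y)"
proof -
  have "\<exists>!es. path T z es y \<and> non_backtracking es"
    using non_backtracking_path_exists[OF assms] non_backtracking_path_unique by blast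
  from theI'[OF this] show "path T z (tree_path z y) y" "non_backtracking (tree_path z y)"
    unfolding tree_path_def by auto
qed

lemma p_hom_C: "y \<in> verts_C \<Longrightarrow> z \<in> verts_C \<Longrightarrow> p z y \<in> hom_C z y"
  unfolding p_def using path_elem_hom_C[OF T_subset tree_path(1)] .

lemma p_carrier [simp]: "y \<in> verts_C \<Longrightarrow> z \<in> verts_C \<Longrightarrow> p z y \<in> carrier W"
  using p_hom_C hom_C_carrier by blast

lemma p_inverse:
  assumes "y \<in> verts_C" "z \<in> verts_C"
  shows "p y z = inv (p z y)"
proof -
  have sub: "set (tree_path z y) \<subseteq> edges_C"
    using path_subset[OF tree_path(1)[OF assms]] T_subset by blast
  have "tree_path y z = map inv_edge (rev (tree_path z y))"
    by (rule non_backtracking_path_unique[OF tree_path(1)[OF assms(2,1)]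
          path_reverse[OF T_subset T_inv tree_path(1)[OF assms]] tree_path(2)[OF assms(2,1)]
          non_backtracking_reverse[OF sub tree_path(2)[OF assms]]])
  then show ?thesis unfolding p_def using path_elem_reverse[OF sub] by simp
qed

section \<open>The two conjugation identities\<close>

lemma conj_mult:
  assumes "a \<in> carrier W" "b \<in> carrier W" "c \<in> carrier W"
  shows "a \<otimes> b \<otimes> c \<otimes> inv (a \<otimes> b) = a \<otimes> (b \<otimes> c \<otimes> inv b) \<otimes> inv a"
  using assms by (simp add: inv_mult_group m_assoc)

text \<open>Collects the tree paths into the conjugator, so that comparing two such elements becomes
  a comparison of conjugators modulo the centraliser of v.\<close>

lemma r_eq_conj:
  assumes "y \<in> verts_C" "w \<in> carrier W" "v \<in> carrier W"
  shows "r w y v = (w \<otimes> p x\<^sub>I y) \<otimes> v \<otimes> inv (w \<otimes> p x\<^sub>I y)"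
  unfolding r_def based_def p_inverse[OF xI_verts assms(1)]
  using assms xI_verts by (simp add: conj_mult p_inverse[of x\<^sub>I y])

lemma r_conj:
  assumes y: "y \<in> verts_C" and [simp]: "u \<in> carrier W" "w \<in> carrier W" "v \<in> carrier W"
  shows "u \<otimes> r w y v \<otimes> inv u = r (u \<otimes> w) y v"
proof -
  have [simp]: "p x\<^sub>I y \<in> carrier W" using y xI_verts by simp
  have "u \<otimes> w \<otimes> p x\<^sub>I y = u \<otimes> (w \<otimes> p x\<^sub>I y)" by (simp add: m_assoc)
  then show ?thesis using y by (simp add: r_eq_conj conj_mult)
qed

lemma g_conj_r:
  assumes loop: "loop_generator y s" and w: "w \<in> Y_I" and A: "A \<in> A_group"
  shows "g A \<otimes> r w y (wgen y s) \<otimes> inv (g A)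
    = r (based x\<^sub>I (twist x\<^sub>I A) (twist y A) (\<tau> A x\<^sub>I y (w \<otimes> p x\<^sub>I y))) (twist y A) (wgen (twist y A) s)"
proof -
  have e: "(y, s) \<in> edges_C" using loop by (simp add: loop_generator_def)
  note y = edge_src(1)[OF e]
  have A': "A \<in> A_tilde" using A by (simp add: A_group_def)
  note yA = twist_verts[OF y A'] and xA = twist_verts[OF xI_verts A']
  have wc [simp]: "w \<in> carrier W" using w by (simp add: Y_I_def hom_Y_def hom_C_def)
  define a b v q p0 p1 where defs: "a = w0 (x\<^sub>I ` A)" "b = w0 (y ` A)" "v = wgen y s"
    "q = p x\<^sub>I y" "p0 = p x\<^sub>I (twist x\<^sub>I A)" "p1 = p x\<^sub>I (twist y A)"
  have [simp]: "a \<in> carrier W" "b \<in> carrier W" "v \<in> carrier W" "q \<in> carrier W" "p0 \<in> carrier W" "p1 \<in> carrier W"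
    unfolding defs using w0_image_carrier[OF y A'] w0_image_carrier[OF xI_verts A'] wgen_carrier[OF e] y yA xA xI_verts
    by auto
  have bb: "b \<otimes> b = \<one>" "inv b = b" and bv: "v \<otimes> b = b \<otimes> v"
    unfolding defs using w0_image_square[OF y A'] w0_image_inv[OF y A'] loop_generator_commute[OF loop A'] by auto
  have bvb: "b \<otimes> v \<otimes> inv b = v"
    unfolding bb(2) bv[symmetric] by (simp add: m_assoc bb(1))
  \<comment> \<open>Since \<open>g A\<close> is \<open>p0 \<otimes> a\<close>, this is the
    conjugator of v on the left-hand side.\<close>
  define h where "h = p0 \<otimes> a \<otimes> w \<otimes> q"
  have [simp]: "h \<in> carrier W" by (simp add: h_def)
  have lhs: "g A \<otimes> r w y (wgen y s) \<otimes> inv (g A) = h \<otimes> v \<otimes> inv h"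
  proof -
    have "g A \<in> carrier W" unfolding g_def by (simp flip: defs)
    then have "g A \<otimes> r w y (wgen y s) \<otimes> inv (g A) = r (g A \<otimes> w) y (wgen y s)"
      using wgen_carrier[OF e] by (intro r_conj[OF y]) auto
    also have "\<dots> = h \<otimes> v \<otimes> inv h"
      unfolding h_def g_def using y by (simp add: r_eq_conj flip: defs)
    finally show ?thesis .
  qed
  have based: "based x\<^sub>I (twist x\<^sub>I A) (twist y A) (\<tau> A x\<^sub>I y (w \<otimes> p x\<^sub>I y)) = h \<otimes> b \<otimes> inv p1"
    unfolding based_def \<tau>_def p_inverse[OF yA xI_verts] h_def defs[symmetric] by (simp add: m_assoc)
  \<comment> \<open>The tree path closing up the based element is undone by the one in
    \<open>r\<close>, leaving the conjugator h b; the factor b disappears because it commutes with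
    v.\<close>
  have "h \<otimes> b \<otimes> inv p1 \<otimes> p1 = h \<otimes> b" by (simp add: m_assoc)
  then have "r (h \<otimes> b \<otimes> inv p1) (twist y A) v = h \<otimes> b \<otimes> v \<otimes> inv (h \<otimes> b)"
    using yA by (simp add: r_eq_conj flip: defs)
  also have "\<dots> = h \<otimes> v \<otimes> inv h"
    by (simp add: conj_mult bvb)
  finally show ?thesis unfolding lhs based wgen_twist[OF y A'] defs(3) by simp
qed

end

theorem proposition5p6:
  fixes W :: "('a, 'b) monoid_scheme" and S I :: "'a set"
    and \<Lambda> :: "'l set" and x\<^sub>I :: "'l \<Rightarrow> 'a" and T :: "(('l \<Rightarrow> 'a) \<times> 'a) set"
    and y :: "'l \<Rightarrow> 'a" and s w u :: 'a and A :: "'l set"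
  assumes "coxeter_groupoid_tree W S I \<Lambda> x\<^sub>I T"
    and "coxeter_groupoid.loop_generator W S \<Lambda> x\<^sub>I y s"
    and "w \<in> coxeter_groupoid.Y_I W S \<Lambda> x\<^sub>I"
    and "u \<in> coxeter_groupoid.Y_I W S \<Lambda> x\<^sub>I"
    and "A \<in> coxeter_groupoid.A_group W S I \<Lambda> x\<^sub>I"
  shows "u \<otimes>\<^bsub>W\<^esub> coxeter_groupoid_tree.r W S \<Lambda> x\<^sub>I T w y (coxeter_groupoid.wgen W S \<Lambda> y s) \<otimes>\<^bsub>W\<^esub> inv\<^bsub>W\<^esub> u
        = coxeter_groupoid_tree.r W S \<Lambda> x\<^sub>I T (u \<otimes>\<^bsub>W\<^esub> w) y (coxeter_groupoid.wgen W S \<Lambda> y s)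
    \<and> coxeter_groupoid_tree.g W S \<Lambda> x\<^sub>I T A
        \<otimes>\<^bsub>W\<^esub> coxeter_groupoid_tree.r W S \<Lambda> x\<^sub>I T w y (coxeter_groupoid.wgen W S \<Lambda> y s)
        \<otimes>\<^bsub>W\<^esub> inv\<^bsub>W\<^esub> (coxeter_groupoid_tree.g W S \<Lambda> x\<^sub>I T A)
        = coxeter_groupoid_tree.r W S \<Lambda> x\<^sub>I T
            (coxeter_groupoid_tree.based W S \<Lambda> x\<^sub>I T x\<^sub>I
               (coxeter_groupoid.twist W S \<Lambda> x\<^sub>I A) (coxeter_groupoid.twist W S \<Lambda> y A)
               (coxeter_groupoid.\<tau> W S A x\<^sub>I y (w \<otimes>\<^bsub>W\<^esub> coxeter_groupoid_tree.p W S \<Lambda> x\<^sub>I T x\<^sub>I y)))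
            (coxeter_groupoid.twist W S \<Lambda> y A)
            (coxeter_groupoid.wgen W S \<Lambda> (coxeter_groupoid.twist W S \<Lambda> y A) s)"
proof -
  interpret coxeter_groupoid_tree W S I \<Lambda> x\<^sub>I T by (rule assms(1))
  have e: "(y, s) \<in> edges_C" using assms(2) by (simp add: loop_generator_def)
  have "w \<in> carrier W" "u \<in> carrier W"
    using assms(3,4) by (auto simp: Y_I_def hom_Y_def hom_C_def)
  then show ?thesis
    using r_conj[OF edge_src(1)[OF e] _ _ wgen_carrier[OF e]] g_conj_r[OF assms(2,3,5)] by blast
qed

end
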